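(* Let $\varphi:\mathbb{R}^2\to\mathbb{R}$ be the refinable function of the Butterfly subdivision scheme with parameter $\omega=\frac1{16}$. Then the Hölder regularity of the scheme is equal to $2$, i.e. $\alpha_\varphi=2$. Moreover, the derivative $\varphi'$ of the limit function is "almost Lipschitz" with logarithmic factor $2$: $$\omega_{\varphi'}(h)\ \asymp\ h\,|\log h|^2,\qquad h\in\Bigl(0,\tfrac12\Bigr).$$
   Context: **The Butterfly scheme.** Consider the regular triangulation of $\mathbb{R}^2$ with vertex set $\mathbb{Z}^2$ and edges in the directions $(1,0),(0,1),(1,1)$, and its dyadic refinements, with vertex sets $2^{-j}\mathbb{Z}^2$ and edges in the same directions. Fix a parameter $\omega$. Given a function on the vertices of one mesh, the scheme defines a function on the vertices of the next refined mesh as follows: values at old vertices are unchanged; the value at the midpoint $X$ of an edge with endpoints $a,b$ is a linear combination of the values at eight neighboring vertices: weight $\frac12$ at $a$ and at $b$; weight $2\omega$ at each of the vertices $c,d$ for which $abc$ and $abd$ are the two triangles of the mesh containing the edge $ab$; and weight $-\omega$ at each of the four vertices $a+c-b,\ b+c-a,\ a+d-b,\ b+d-a$ (the remaining vertices of the triangles adjacent to $abc$ and $abd$ along the edges $ac$, $bc$, $ad$, $bd$). Each function is extended from its mesh to the plane by linearity on the triangles. The refinable function $\varphi$ of the scheme is the uniform limit of the resulting sequence of functions when the initial data on $\mathbb{Z}^2$ is the $\delta$-function, equal to one at the origin and to zero at all other vertices. **Regularity.** The modulus of continuity of a function $f$ (scalar or vector valued) on $\mathbb{R}^2$ is $\omega_f(h)=\sup\{\|f(x+\xi)-f(x)\|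 : x,\xi\in\mathbb{R}^2,\ \|\xi\|\le h\}$. The Hölder exponent of $f$ is $$\alpha_f=n+\sup\{\alpha\ge0 : \text{there is a constant } C \text{ with } \omega_{f^{(n)}}(h)\le C h^{\alpha}\text{ for all }h>0\},$$ where $n$ is the largest integer such that $f\in C^n(\mathbb{R}^2)$ and $f^{(n)}$ is the $n$-th derivative. The Hölder regularity of the scheme is $\alpha_\varphi$. The notation $F(h)\asymp G(h)$ means equivalence up to multiplication by a constant: $c\,G(h)\le F(h)\le C\,G(h)$ for some constants $c,C>0$ and all $h$ in the indicated range. *)

theory Defs
  imports "HOL-Analysis.Analysis"
begin

section \<open>The Butterfly scheme\<close>

text \<open>
  A function on the mesh of level \<open>j\<close>, whose vertex set is \<open>2\<^sup>-\<^sup>j \<int>\<^sup>2\<close>, is represented by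
  \<open>f :: int \<times> int \<Rightarrow> real\<close>, where \<open>f k\<close> is the value at the vertex \<open>k / 2\<^sup>j\<close>.

  The value at the midpoint of the edge with endpoints \<open>a\<close>, \<open>b\<close>; the triangles containing
  this edge are \<open>abc\<close> and \<open>abd\<close>.
\<close>

definition butterfly_midpoint ::
  "real \<Rightarrow> (int \<times> int \<Rightarrow> real) \<Rightarrow> int \<times> int \<Rightarrow> int \<times> int \<Rightarrow> int \<times> int \<Rightarrow> int \<times> int \<Rightarrow> real"
  where
  "butterfly_midpoint \<omega> f a b c d =
     1 / 2 * (f a + f b) + 2 * \<omega> * (f c + f d)
     - \<omega> * (f (a + c - b) + f (b + c - a) + f (a + d - b) + f (b + d - a))"

text \<open>
  One step of the scheme: \<open>butterfly_step \<omega> f (m, n)\<close> is the new value at the vertex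
  \<open>(m, n) / 2\<^sup>j\<^sup>+\<^sup>1\<close>. If \<open>m\<close> and \<open>n\<close> are even this is the old vertex \<open>p = (m div 2, n div 2)\<close>;
  otherwise it is the midpoint of the edge from \<open>p\<close> to \<open>p + e\<close>, where
  \<open>e = (m mod 2, n mod 2)\<close> is \<open>(1, 0)\<close>, \<open>(0, 1)\<close> or \<open>(1, 1)\<close>.
\<close>

definition butterfly_step :: "real \<Rightarrow> (int \<times> int \<Rightarrow> real) \<Rightarrow> int \<times> int \<Rightarrow> real" where
  "butterfly_step \<omega> f = (\<lambda>(m, n).
     let p = (m div 2, n div 2) in
       if even m \<and> even n then f p
       else if odd m \<and> even n then
         butterfly_midpoint \<omega> f p (p + (1, 0)) (p + (1, 1)) (p - (0, 1))
       else if even m \<and> odd n then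
         butterfly_midpoint \<omega> f p (p + (0, 1)) (p + (1, 1)) (p - (1, 0))
       else
         butterfly_midpoint \<omega> f p (p + (1, 1)) (p + (1, 0)) (p + (0, 1)))"

definition delta_data :: "int \<times> int \<Rightarrow> real" where
  "delta_data k = (if k = (0, 0) then 1 else 0)"

definition butterfly_data :: "real \<Rightarrow> nat \<Rightarrow> int \<times> int \<Rightarrow> real" where
  "butterfly_data \<omega> j = (butterfly_step \<omega> ^^ j) delta_data"

text \<open>
  The extension of \<open>f\<close> from \<open>\<int>\<^sup>2\<close> to the plane that is linear on the triangles of the
  triangulation with edge directions \<open>(1, 0)\<close>, \<open>(0, 1)\<close>, \<open>(1, 1)\<close>. The unit square with lower
  left corner \<open>(m, n)\<close> is cut by its diagonal from \<open>(m, n)\<close> to \<open>(m + 1, n + 1)\<close> into two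
  triangles, and the coefficients below are the barycentric coordinates of \<open>x\<close> in the triangle
  that contains it.
\<close>

definition linear_extension :: "(int \<times> int \<Rightarrow> real) \<Rightarrow> real^2 \<Rightarrow> real" where
  "linear_extension f x =
     (let m = \<lfloor>x $ 1\<rfloor>; n = \<lfloor>x $ 2\<rfloor>; s = frac (x $ 1); t = frac (x $ 2) in
       if t \<le> s
       then (1 - s) * f (m, n) + (s - t) * f (m + 1, n) + t * f (m + 1, n + 1)
       else (1 - t) * f (m, n) + (t - s) * f (m, n + 1) + s * f (m + 1, n + 1))"

definition butterfly_approx :: "real \<Rightarrow> nat \<Rightarrow> real^2 \<Rightarrow> real" where
  "butterfly_approx \<omega> j x = linear_extension (butterfly_data \<omega> j) (2 ^ j *\<^sub>R x)"

definition refinable_function :: "real \<Rightarrow> real^2 \<Rightarrow> real" where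
  "refinable_function \<omega> =
     (THE \<phi>. uniform_limit UNIV (butterfly_approx \<omega>) \<phi> sequentially)"


section \<open>Regularity\<close>

fun Cn :: "nat \<Rightarrow> ('a::real_normed_vector \<Rightarrow> 'b::real_normed_vector) \<Rightarrow> bool" where
  "Cn 0 f \<longleftrightarrow> continuous_on UNIV f"
| "Cn (Suc n) f \<longleftrightarrow>
     (\<forall>x. f differentiable (at x)) \<and> (\<forall>v. Cn n (\<lambda>x. frechet_derivative f (at x) v))"

text \<open>
  \<open>iterated_derivative f [v\<^sub>1, \<dots>, v\<^sub>n] x\<close> is the value of the \<open>n\<close>-th derivative of \<open>f\<close> at
  \<open>x\<close>, an \<open>n\<close>-linear map, on \<open>v\<^sub>1, \<dots>, v\<^sub>n\<close>.
\<close>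

fun iterated_derivative ::
  "('a::real_normed_vector \<Rightarrow> 'b::real_normed_vector) \<Rightarrow> 'a list \<Rightarrow> 'a \<Rightarrow> 'b" where
  "iterated_derivative f [] x = f x"
| "iterated_derivative f (v # vs) x =
     iterated_derivative (\<lambda>y. frechet_derivative f (at y) v) vs x"

text \<open>
  The distance between the \<open>n\<close>-th derivatives of \<open>f\<close> at \<open>x\<close> and at \<open>y\<close> in the operator norm of
  \<open>n\<close>-linear maps; for \<open>n = 0\<close> it is \<open>norm (f x - f y)\<close>.
\<close>

definition derivative_dist ::
  "nat \<Rightarrow> ('a::real_normed_vector \<Rightarrow> 'b::real_normed_vector) \<Rightarrow> 'a \<Rightarrow> 'a \<Rightarrow> ennreal" where
  "derivative_dist n f x y =
     (SUP vs\<in>{vs. length vs = n \<and> (\<forall>v\<in>set vs. norm v \<le> 1)}.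
        ennreal (norm (iterated_derivative f vs x - iterated_derivative f vs y)))"

text \<open>The modulus of continuity of the \<open>n\<close>-th derivative of \<open>f\<close>; it may be infinite.\<close>

definition derivative_modulus ::
  "nat \<Rightarrow> ('a::real_normed_vector \<Rightarrow> 'b::real_normed_vector) \<Rightarrow> real \<Rightarrow> ennreal" where
  "derivative_modulus n f h =
     (SUP (x, \<xi>)\<in>{(x, \<xi>). norm \<xi> \<le> h}. derivative_dist n f (x + \<xi>) x)"

text \<open>
  As in the usual definition, the value is meaningful only if \<open>f\<close> is continuous and not
  \<open>C\<^sup>\<infinity>\<close>, so that the largest \<open>n\<close> with \<open>Cn n f\<close> exists.
\<close>

definition holder_exponent ::
  "('a::real_normed_vector \<Rightarrow> 'b::real_normed_vector) \<Rightarrow> ereal" where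
  "holder_exponent f =
     (let n = (GREATEST n. Cn n f) in
       ereal (real n) +
       (SUP \<alpha>\<in>{\<alpha>. 0 \<le> \<alpha> \<and>
                  (\<exists>C. \<forall>h>0. derivative_modulus n f h \<le> ennreal (C * h powr \<alpha>))}.
          ereal \<alpha>))"

end

theory Submission
  imports Defs
begin

text \<open>
  At every vertex the mixed second differences \<open>u = 4\<^sup>n \<Delta>\<^sub>1\<Delta>\<^sub>2 f\<^sub>n\<close> of the subdivided data again satisfy
  a scalar subdivision scheme, and so do their differences \<open>w\<close> in the diagonal direction \<open>(1, 1)\<close>.
  The three layers \<open>w\<close>, \<open>d = \<Delta>\<^sub>1 u\<close> and \<open>u\<close> behave like the blocks of a triangular matrix with
  diagonal blocks of growth one. The sequence \<open>w\<close> stays bounded: away from the vertices of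
  the coarse meshes the scheme is contractive, and on the hexagon of neighbours of a fixed
  vertex the values grow by at most half the value at the vertex, which itself is halved in every
  step. Since the scheme for \<open>d\<close> has norm one up to terms in \<open>w\<close>, and the scheme for \<open>u\<close>
  has norm one up to terms in \<open>d\<close> and \<open>w\<close>, \<open>d\<close> grows at most linearly and \<open>u\<close> at most
  quadratically. By the rotation symmetry of the data all second differences at level \<open>n\<close>
  are then \<open>O(n\<^sup>2 / 4\<^sup>n)\<close>, so the first divided differences converge to the partial derivatives with
  error \<open>O(n\<^sup>2 / 2\<^sup>n)\<close>, which is the upper bound for the modulus.
  For the lower bound, the values at the vertices around the origin follow a three-dimensional
  recursion whose matrix is similar to a single Jordan block for the eigenvalue \<open>1/4\<close>; hence
  \<open>4\<^sup>n (\<phi> 0 - \<phi> (2\<^sup>-\<^sup>n, 0))\<close> is a quadratic polynomial in \<open>n\<close>.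
\<close>

section \<open>The schemes for second and third differences\<close>

abbreviation step :: "(int \<times> int \<Rightarrow> real) \<Rightarrow> int \<times> int \<Rightarrow> real" where
  "step \<equiv> butterfly_step (1 / 16)"

lemma step_even_even: "step f (2 * m, 2 * n) = f (m, n)"
  by (simp add: butterfly_step_def)

lemma step_odd_even: "step f (2 * m + 1, 2 * n) =
    (f (m, n) + f (m + 1, n)) / 2 + (f (m + 1, n + 1) + f (m, n - 1)) / 8
    - (f (m, n + 1) + f (m + 2, n + 1) + f (m - 1, n - 1) + f (m + 1, n - 1)) / 16"
  by (simp add: butterfly_step_def butterfly_midpoint_def Let_def algebra_simps add_divide_distrib)

lemma step_even_odd: "step f (2 * m, 2 * n + 1) =
    (f (m, n) + f (m, n + 1)) / 2 + (f (m + 1, n + 1) + f (m - 1, n)) / 8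
    - (f (m + 1, n) + f (m + 1, n + 2) + f (m - 1, n - 1) + f (m - 1, n + 1)) / 16"
  by (simp add: butterfly_step_def butterfly_midpoint_def Let_def algebra_simps add_divide_distrib)

lemma step_odd_odd: "step f (2 * m + 1, 2 * n + 1) =
    (f (m, n) + f (m + 1, n + 1)) / 2 + (f (m + 1, n) + f (m, n + 1)) / 8
    - (f (m, n - 1) + f (m + 2, n + 1) + f (m - 1, n) + f (m + 1, n + 2)) / 16"
  by (simp add: butterfly_step_def butterfly_midpoint_def Let_def algebra_simps add_divide_distrib)

definition mixed_diff :: "(int \<times> int \<Rightarrow> real) \<Rightarrow> int \<times> int \<Rightarrow> real" where
  "mixed_diff f = (\<lambda>(m, n). f (m + 1, n + 1) - f (m + 1, n) - f (m, n + 1) + f (m, n))"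

lemma int_add_1_1: "x + 1 + 1 = x + (2 :: int)"
  by simp

text \<open>The subdivision rules one vertex further on, in the form to which \<open>simp\<close>
  brings arguments such as \<open>2 * m + 1 + 1\<close>; \<open>int_add_1_1\<close> serves the same
  normalization.\<close>

lemma step_shift:
  "step f (2 * m + 2, 2 * n) = f (m + 1, n)"
  "step f (2 * m, 2 * n + 2) = f (m, n + 1)"
  "step f (2 * m + 2, 2 * n + 2) = f (m + 1, n + 1)"
  "step f (2 * m + 2, 2 * n + 1) =
    (f (m + 1, n) + f (m + 1, n + 1)) / 2 + (f (m + 2, n + 1) + f (m, n)) / 8
    - (f (m + 2, n) + f (m + 2, n + 2) + f (m, n - 1) + f (m, n + 1)) / 16"
  "step f (2 * m + 1, 2 * n + 2) =
    (f (m, n + 1) + f (m + 1, n + 1)) / 2 + (f (m + 1, n + 2) + f (m, n)) / 8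
    - (f (m, n + 2) + f (m + 2, n + 2) + f (m - 1, n) + f (m + 1, n)) / 16"
  using step_even_even[of f "m + 1" n] step_even_even[of f m "n + 1"]
    step_even_even[of f "m + 1" "n + 1"] step_even_odd[of f "m + 1" n] step_odd_even[of f m "n + 1"]
  by (simp_all add: field_simps)

definition dscheme :: "(int \<times> int \<Rightarrow> real) \<Rightarrow> (int \<times> int \<Rightarrow> real) \<Rightarrow> bool" where
  "dscheme u u' \<longleftrightarrow> (\<forall>m n.
     u' (2 * m, 2 * n) = u (m, n) + u (m - 1, n - 1) / 2 - (u (m - 1, n) + u (m, n - 1)) / 4 \<and>
     u' (2 * m + 1, 2 * n + 1) =
       u (m, n) + u (m + 1, n + 1) / 2 - (u (m + 1, n) + u (m, n + 1)) / 4 \<and>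
     u' (2 * m + 1, 2 * n) =
       u (m, n) + (u (m + 1, n) + u (m, n - 1) - u (m + 1, n + 1) - u (m - 1, n - 1)) / 4 \<and>
     u' (2 * m, 2 * n + 1) =
       u (m, n) + (u (m, n + 1) + u (m - 1, n) - u (m + 1, n + 1) - u (m - 1, n - 1)) / 4)"

text \<open>
  \<open>dscheme\<close> is the scheme of \<open>u\<close> and \<open>tscheme\<close> that of \<open>w\<close>. The latter is invariant under all
  symmetries of the triangulation: the midpoint of \<open>ab\<close> gets weight \<open>1/2\<close> from \<open>a\<close> and \<open>b\<close> and
  weight \<open>-1/4\<close> from the two vertices opposite to \<open>ab\<close>, and old values are halved.
\<close>

definition tscheme :: "(int \<times> int \<Rightarrow> real) \<Rightarrow> (int \<times> int \<Rightarrow> real) \<Rightarrow> bool" where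
  "tscheme w w' \<longleftrightarrow> (\<forall>m n.
     w' (2 * m, 2 * n) = w (m, n) / 2 \<and>
     w' (2 * m + 1, 2 * n) = (w (m, n) + w (m + 1, n)) / 2 - (w (m + 1, n + 1) + w (m, n - 1)) / 4 \<and>
     w' (2 * m, 2 * n + 1) = (w (m, n) + w (m, n + 1)) / 2 - (w (m + 1, n + 1) + w (m - 1, n)) / 4 \<and>
     w' (2 * m + 1, 2 * n + 1) =
       (w (m, n) + w (m + 1, n + 1)) / 2 - (w (m + 1, n) + w (m, n + 1)) / 4)"

text \<open>The factor 4 compensates the halved mesh width in both directions; with it the weights
  of each of the four rules sum to one. The identities themselves follow by expanding the
  subdivision rules.\<close>

lemma dscheme_mixed_diff: "dscheme (mixed_diff f) (\<lambda>k. 4 * mixed_diff (step f) k)"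
  unfolding dscheme_def mixed_diff_def
  by (simp add: step_even_even step_odd_even step_even_odd step_odd_odd step_shift int_add_1_1) (simp add: field_simps)?

text \<open>No further factor is put in, so \<open>w\<close> is a third difference scaled only by 4
  per level. Its rules have weight sum 1/2, but at midpoints the absolute weights sum to 3/2, so
  boundedness does not follow from one step.\<close>

lemma tscheme_diagonal_diff:
  assumes "dscheme u u'"
  shows "tscheme (\<lambda>(m, n). u (m, n) - u (m - 1, n - 1)) (\<lambda>(m, n). u' (m, n) - u' (m - 1, n - 1))"
proof -
  note D = assms[unfolded dscheme_def, rule_format]
  have "u' (2 * m - 1, 2 * n - 1) = u (m - 1, n - 1) + u (m, n) / 2 - (u (m, n - 1) + u (m - 1, n)) / 4"
    "u' (2 * m, 2 * n - 1) = 
       u (m, n - 1) + (u (m, n) + u (m - 1, n - 1) - u (m + 1, n) - u (m - 1, n - 2)) / 4"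
    "u' (2 * m - 1, 2 * n) = 
       u (m - 1, n) + (u (m, n) + u (m - 1, n - 1) - u (m, n + 1) - u (m - 2, n - 1)) / 4" for m n
    using D[of "m - 1" "n - 1"] D[of m "n - 1"] D[of "m - 1" n] by (auto simp: field_simps)
  then show ?thesis using D
    unfolding tscheme_def by simp (simp add: field_simps)?
qed

lemma int_parity_cases:
  fixes k :: "int \<times> int"
  obtains m n where "k = (2 * m, 2 * n)" | m n where "k = (2 * m + 1, 2 * n)"
  | m n where "k = (2 * m, 2 * n + 1)" | m n where "k = (2 * m + 1, 2 * n + 1)"
proof -
  obtain a b where k: "k = (a, b)" by (cases k)
  show ?thesis
    by (cases "even a"; cases "even b") (auto elim!: evenE oddE simp: k intro: that)
qed

text \<open>In every parity case a horizontal difference of \<open>u'\<close> is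
  \<open>3/4 d - 1/4 d + 1/4 w - 1/4 w\<close> at suitable vertices, with total absolute weight one
  on \<open>d\<close>, and a value of \<open>u'\<close> is one value of \<open>u\<close> plus two
  values of \<open>d\<close> and one of \<open>w\<close>, each with weight 1/4 up to sign.\<close>

lemma dscheme_growth:
  assumes D: "dscheme u u'"
    and w: "\<And>m n. \<bar>u (m, n) - u (m - 1, n - 1)\<bar> \<le> W"
    and d: "\<And>m n. \<bar>u (m + 1, n) - u (m, n)\<bar> \<le> D"
  shows "\<bar>u' (m + 1, n) - u' (m, n)\<bar> \<le> D + W / 2"
    and "(\<And>k. \<bar>u k\<bar> \<le> U) \<Longrightarrow> \<bar>u' k\<bar> \<le> U + D / 2 + W / 4"
proof -
  note D = D[unfolded dscheme_def, rule_format]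
  have D2: "u' (2 * m + 2, 2 * n) = u (m + 1, n) + u (m, n - 1) / 2 - (u (m, n) + u (m + 1, n - 1)) / 4"
    "u' (2 * m + 2, 2 * n + 1) =
       u (m + 1, n) + (u (m + 1, n + 1) + u (m, n) - u (m + 2, n + 1) - u (m, n - 1)) / 4" for m n
    using D[of "m + 1" n] by (auto simp: field_simps)
  have tri: "\<bar>3/4 * x - 1/4 * y + 1/4 * p - 1/4 * q\<bar> \<le> D + W / 2"
    if "\<bar>x\<bar> \<le> D" "\<bar>y\<bar> \<le> D" "\<bar>p\<bar> \<le> W" "\<bar>q\<bar> \<le> W" for x y p q
    using that by linarith
  let ?d = "\<lambda>m n. u (m + 1, n) - u (m, n)" and ?w = "\<lambda>m n. u (m, n) - u (m - 1, n - 1)"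
  show "\<bar>u' (m + 1, n) - u' (m, n)\<bar> \<le> D + W / 2"
  proof (cases "(m, n)" rule: int_parity_cases)
    case (1 p q)
    have "u' (m + 1, n) - u' (m, n) = 3/4 * ?d (p - 1) (q - 1) - 1/4 * ?d (p - 1) q
        + 1/4 * ?w (p + 1) q - 1/4 * ?w (p + 1) (q + 1)"
      using 1 by (simp add: D) (simp add: field_simps)?
    then show ?thesis using tri[OF d d w w] by metis
  next
    case (2 p q)
    have "u' (m + 1, n) - u' (m, n) = 3/4 * ?d p q - 1/4 * ?d p (q - 1)
        + 1/4 * ?w (p + 1) (q + 1) - 1/4 * ?w p q"
      using 2 by (simp add: D D2 int_add_1_1) (simp add: field_simps)?
    then show ?thesis using tri[OF d d w w] by metis
  next
    case (3 p q)
    have "u' (m + 1, n) - u' (m, n) = 3/4 * ?d p (q + 1) - 1/4 * ?d p q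
        + 1/4 * ?w p (q + 1) - 1/4 * ?w p q"
      using 3 by (simp add: D D2 int_add_1_1) (simp add: field_simps)?
    then show ?thesis using tri[OF d d w w] by metis
  next
    case (4 p q)
    have "u' (m + 1, n) - u' (m, n) = 3/4 * ?d p q - 1/4 * ?d p (q + 1)
        + 1/4 * ?w (p + 1) q - 1/4 * ?w (p + 2) (q + 1)"
      using 4 by (simp add: D D2 int_add_1_1) (simp add: field_simps)?
    then show ?thesis using tri[OF d d w w] by metis
  qed
  assume U: "\<And>k. \<bar>u k\<bar> \<le> U"
  have tri: "\<bar>z + 1/4 * x - 1/4 * y + 1/4 * p\<bar> \<le> U + D / 2 + W / 4"
    if "\<bar>x\<bar> \<le> D" "\<bar>y\<bar> \<le> D" "\<bar>p\<bar> \<le> W" "\<bar>z\<bar> \<le> U" for x y p z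
    using that by linarith
  have dm: "\<bar>- ?d m n\<bar> \<le> D" and wm: "\<bar>- ?w m n\<bar> \<le> W" for m n
    using d[of m n] w[of m n] by linarith+
  show "\<bar>u' k\<bar> \<le> U + D / 2 + W / 4"
  proof (cases k rule: int_parity_cases)
    case (1 p q)
    have "u' k = u (p, q) + 1/4 * ?d (p - 1) q - 1/4 * ?d (p - 1) (q - 1) + 1/4 * (- ?w p q)"
      using 1 by (simp add: D) (simp add: field_simps)?
    then show ?thesis using tri[OF d d wm U] by metis
  next
    case (2 p q)
    have "u' k = u (p, q) + 1/4 * ?d p q - 1/4 * (- ?d (p - 1) (q - 1)) + 1/4 * (- ?w (p + 1) (q + 1))"
      using 2 by (simp add: D) (simp add: field_simps)?
    then show ?thesis using tri[OF d dm wm U] by metis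
  next
    case (3 p q)
    have "u' k = u (p, q) + 1/4 * (- ?d p (q + 1)) - 1/4 * ?d (p - 1) q + 1/4 * ?w p q"
      using 3 by (simp add: D) (simp add: field_simps)?
    then show ?thesis using tri[OF dm d w U] by metis
  next
    case (4 p q)
    have "u' k = u (p, q) + 1/4 * ?d p (q + 1) - 1/4 * ?d p q + 1/4 * ?w (p + 1) (q + 1)"
      using 4 by (simp add: D) (simp add: field_simps)?
    then show ?thesis using tri[OF d d w U] by metis
  qed
qed

section \<open>Boundedness of the diagonal differences\<close>

text \<open>The linear symmetry of order six of the triangulation, (1, 0) to (1, 1) to (0, 1) to
  (-1, 0); it is the rotation by 60 degrees if the triangles are drawn equilateral.\<close>

definition rot :: "int \<times> int \<Rightarrow> int \<times> int" where
  "rot = (\<lambda>(m, n). (m - n, m))"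

definition dil :: "int \<Rightarrow> int \<times> int \<Rightarrow> int \<times> int" where
  "dil c = (\<lambda>(m, n). (c * m, c * n))"

definition hexagon :: "(int \<times> int) set" where
  "hexagon = {(1, 0), (1, 1), (0, 1), (-1, 0), (-1, -1), (0, -1)}"

lemma rot_power_add: "(rot ^^ i) (x + y) = (rot ^^ i) x + (rot ^^ i) y"
  by (induction i) (auto simp: rot_def split_beta prod_eq_iff)

lemma rot_power_dil: "(rot ^^ i) (dil c x) = dil c ((rot ^^ i) x)"
  by (induction i) (auto simp: rot_def dil_def split_beta prod_eq_iff algebra_simps)

lemma dil_add: "dil c (x + y) = dil c x + dil c y"
  by (auto simp: dil_def split_beta prod_eq_iff algebra_simps)

lemma dil_dil: "dil c (dil d x) = dil (c * d) x"
  by (auto simp: dil_def split_beta prod_eq_iff algebra_simps)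

lemma rot_power_hexagon: "(rot ^^ i) ` hexagon = hexagon"
proof (induction i)
  case (Suc i)
  have "(rot ^^ Suc i) ` hexagon = rot ` ((rot ^^ i) ` hexagon)"
    by (simp add: image_comp)
  also have "\<dots> = hexagon"
    unfolding Suc by (auto simp: hexagon_def rot_def)
  finally show ?case .
qed simp

text \<open>The rotation permutes the three edge directions, so each rule for the rotated functions
  is an original rule at a rotated vertex; \<open>T3\<close> lists these instances.\<close>

lemma tscheme_rot:
  assumes "tscheme w w'"
  shows "tscheme (\<lambda>k. w (rot k)) (\<lambda>k. w' (rot k))"
proof -
  note T = assms[unfolded tscheme_def, rule_format]
  have T2: "w' (2 * m - 1, 2 * n) =
      (w (m - 1, n) + w (m, n)) / 2 - (w (m, n + 1) + w (m - 1, n - 1)) / 4" for m n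
    using T[of "m - 1" n] by (simp add: algebra_simps)
  have T3: "w' (1 + 2 * m - 2 * n, 2 * m) =
      (w (m - n, m) + w (m - n + 1, m)) / 2 - (w (m - n + 1, m + 1) + w (m - n, m - 1)) / 4"
    "w' (2 * m - 2 * n, 2 * m) = w (m - n, m) / 2"
    "w' (1 + 2 * m - 2 * n, 1 + 2 * m) =
      (w (m - n, m) + w (m - n + 1, m + 1)) / 2 - (w (m - n + 1, m) + w (m - n, m + 1)) / 4"
    "w' (2 * m - 2 * n - 1, 2 * m) =
      (w (m - n - 1, m) + w (m - n, m)) / 2 - (w (m - n, m + 1) + w (m - n - 1, m - 1)) / 4"
    "w' (2 * m - 2 * n, 1 + 2 * m) = 
      (w (m - n, m) + w (m - n, m + 1)) / 2 - (w (m - n + 1, m + 1) + w (m - n - 1, m)) / 4"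
    for m n
    using T[of "m - n" m] T2[of "m - n" m] by (simp_all add: algebra_simps)
  show ?thesis
    unfolding tscheme_def rot_def using T3
    by (simp add: algebra_simps)
qed

lemma tscheme_rot_power:
  "tscheme w w' \<Longrightarrow> tscheme (\<lambda>k. w ((rot ^^ i) k)) (\<lambda>k. w' ((rot ^^ i) k))"
proof (induction i arbitrary: w w')
  case (Suc i)
  from tscheme_rot[OF Suc.IH[OF Suc.prems]] show ?case
    by (simp add: funpow_swap1)
qed simp

lemma tscheme_shift:
  assumes "tscheme w w'"
  shows "tscheme (\<lambda>k. w (k + a)) (\<lambda>k. w' (k + dil 2 a))"
proof -
  obtain p q where a: "a = (p, q)" by (cases a)
  note T = assms[unfolded tscheme_def, rule_format]
  have "w' (2 * m + 2 * p, 2 * n + 2 * q) = w (m + p, n + q) / 2"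
    "w' (2 * m + 1 + 2 * p, 2 * n + 2 * q) = (w (m + p, n + q) + w (m + 1 + p, n + q)) / 2
      - (w (m + 1 + p, n + 1 + q) + w (m + p, n - 1 + q)) / 4"
    "w' (2 * m + 2 * p, 2 * n + 1 + 2 * q) = (w (m + p, n + q) + w (m + p, n + 1 + q)) / 2
      - (w (m + 1 + p, n + 1 + q) + w (m - 1 + p, n + q)) / 4"
    "w' (2 * m + 1 + 2 * p, 2 * n + 1 + 2 * q) =
      (w (m + p, n + q) + w (m + 1 + p, n + 1 + q)) / 2 - (w (m + 1 + p, n + q) + w (m + p, n + 1 + q)) / 4"
    for m n
    using T[of "m + p" "n + q"] by (simp_all add: algebra_simps)
  then show ?thesis
    unfolding tscheme_def a dil_def by simp
qed

section \<open>The ring of neighbours of a fixed vertex\<close>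

lemma tscheme_hexagon:
  assumes "tscheme w w'"
  shows "w' (1, 0) = (w (0, 0) + w (1, 0)) / 2 - (w (1, 1) + w (0, -1)) / 4"
    "w' (0, 1) = (w (0, 0) + w (0, 1)) / 2 - (w (1, 1) + w (-1, 0)) / 4"
    "w' (1, 1) = (w (0, 0) + w (1, 1)) / 2 - (w (1, 0) + w (0, 1)) / 4"
    "w' (-1, 0) = (w (0, 0) + w (-1, 0)) / 2 - (w (0, 1) + w (-1, -1)) / 4"
    "w' (0, -1) = (w (0, 0) + w (0, -1)) / 2 - (w (1, 0) + w (-1, -1)) / 4"
    "w' (-1, -1) = (w (0, 0) + w (-1, -1)) / 2 - (w (0, -1) + w (-1, 0)) / 4"
  using assms[unfolded tscheme_def, rule_format, of 0 0] assms[unfolded tscheme_def, rule_format, of "-1" 0]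
    assms[unfolded tscheme_def, rule_format, of 0 "-1"] assms[unfolded tscheme_def, rule_format, of "-1" "-1"]
  by simp_all

lemma abs_tscheme_le:
  fixes x :: real
  assumes "\<bar>x\<bar> \<le> a" "\<bar>y\<bar> \<le> b" "\<bar>z\<bar> \<le> c" "\<bar>t\<bar> \<le> d"
  shows "\<bar>(x + y) / 2 - (z + t) / 4\<bar> \<le> (a + b) / 2 + (c + d) / 4"
proof -
  have "\<bar>1/2 * x + 1/2 * y - 1/4 * z - 1/4 * t\<bar> \<le> 1/2 * a + 1/2 * b + 1/4 * c + 1/4 * d"
    using assms by linarith
  then show ?thesis by (simp add: field_simps)
qed

text \<open>The new ring depends only on the old ring and the centre, with absolute weights 1/2 +
  1/4 + 1/4 = 1 on the ring and 1/2 on the centre.\<close>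

lemma tscheme_ring_step:
  assumes "tscheme w w'" and R: "\<And>e. e \<in> hexagon \<Longrightarrow> \<bar>w e\<bar> \<le> R" and X: "\<bar>w (0, 0)\<bar> \<le> X"
    and e: "e \<in> hexagon"
  shows "\<bar>w' e\<bar> \<le> R + X / 2"
proof -
  have *: "\<bar>(w (0, 0) + w x) / 2 - (w y + w z) / 4\<bar> \<le> R + X / 2"
    if "x \<in> hexagon" "y \<in> hexagon" "z \<in> hexagon" for x y z
    using abs_tscheme_le[OF X R R R, OF that] by (simp add: field_simps)
  show ?thesis
    using e unfolding hexagon_def
    by (elim insertE emptyE; hypsubst) (unfold tscheme_hexagon[OF assms(1)], (rule *; simp add: hexagon_def)+)
qed

text \<open>The centre is halved in each step, so the increments of the ring bound form a geometric
  series with sum at most \<open>X\<close>.\<close>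

lemma tscheme_ring_iterate:
  assumes T: "\<And>n. tscheme (w n) (w (Suc n))"
    and R: "\<And>e. e \<in> hexagon \<Longrightarrow> \<bar>w 0 e\<bar> \<le> R" and X: "\<bar>w 0 (0, 0)\<bar> \<le> X"
    and e: "e \<in> hexagon"
  shows "\<bar>w t e\<bar> \<le> R + X"
proof -
  have centre: "\<bar>w t (0, 0)\<bar> \<le> X / 2 ^ t" for t
  proof (induction t)
    case (Suc t)
    have "w (Suc t) (0, 0) = w t (0, 0) / 2"
      using T[of t, unfolded tscheme_def, rule_format, of 0 0] by simp
    then show ?case using Suc by simp
  qed (use X in simp)
  have "\<bar>w t e\<bar> \<le> R + X * (1 - 1 / 2 ^ t)" if "e \<in> hexagon" for e
    using that
  proof (induction t arbitrary: e)
    case (Suc t)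
    have "\<bar>w (Suc t) e\<bar> \<le> R + X * (1 - 1 / 2 ^ t) + X / 2 ^ t / 2"
      by (rule tscheme_ring_step[OF T Suc.IH centre Suc.prems])
    then show ?case by (simp add: field_simps)
  qed (use R in simp)
  from this[OF e] have "\<bar>w t e\<bar> \<le> R + X * (1 - 1 / 2 ^ t)" .
  also have "\<dots> \<le> R + X"
    using order.trans[OF abs_ge_zero X] by (simp add: algebra_simps)
  finally show ?thesis .
qed

text \<open>After two steps (2, 1) is the midpoint of an edge joining two midpoints of coarse edges.
  Cancellation in the two-step rule leaves absolute weights with sum 7/16 + 1/8 + 1/8 + 1/16 =
  3/4.\<close>

lemma tscheme_inner_edge:
  assumes "tscheme w w'" "tscheme w' w''" and C: "\<And>k. \<bar>w k\<bar> \<le> C"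
  shows "\<bar>w'' (2, 1)\<bar> \<le> 3 / 4 * C"
proof -
  note T = assms(1)[unfolded tscheme_def, rule_format] and T' = assms(2)[unfolded tscheme_def, rule_format]
  have "w'' (2, 1) = 7/16 * w (0, 0) - w (0, -1) / 8 - w (0, 1) / 8 + w (2, 1) / 16"
    using T[of 0 0] T[of 1 0] T'[of 1 0] by simp (simp add: field_simps)?
  then show ?thesis
    using C[of "(0, 0)"] C[of "(0, -1)"] C[of "(0, 1)"] C[of "(2, 1)"] by linarith
qed

text \<open>The vertex \<open>(1, 0)\<close> of the first refinement stays at \<open>(2\<^sup>t, 0)\<close> after \<open>t\<close> further steps.\<close>

lemma tscheme_new_vertex:
  assumes T: "\<And>n. tscheme (w n) (w (Suc n))" and C: "\<And>k. \<bar>w 0 k\<bar> \<le> C"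
  shows "\<bar>w 3 (5, 0)\<bar> \<le> 13 / 16 * C" "\<bar>w 3 (3, 0)\<bar> \<le> 13 / 16 * C"
    "\<bar>w 3 (5, 1)\<bar> \<le> 9 / 16 * C" "\<bar>w 3 (4, 1)\<bar> \<le> 9 / 16 * C"
    "\<bar>w 3 (3, -1)\<bar> \<le> 9 / 16 * C" "\<bar>w 3 (4, -1)\<bar> \<le> 9 / 16 * C"
proof -
  note T = T[unfolded tscheme_def, rule_format]
  have s: "Suc 0 = 1" "Suc 1 = 2" "Suc 2 = 3" by simp_all
  note T0 = T[where n = 0, unfolded s] and T1 = T[where n = 1, unfolded s] and T2 = T[where n = 2, unfolded s]
  have w1: "w 1 (0, -1) = (w 0 (0, -1) + w 0 (0, 0)) / 2 - (w 0 (1, 0) + w 0 (-1, -1)) / 4"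
    "w 1 (0, 0) = w 0 (0, 0) / 2"
    "w 1 (1, -1) = (w 0 (0, -1) + w 0 (1, 0)) / 2 - (w 0 (1, -1) + w 0 (0, 0)) / 4"
    "w 1 (1, 0) = (w 0 (0, 0) + w 0 (1, 0)) / 2 - (w 0 (1, 1) + w 0 (0, -1)) / 4"
    "w 1 (1, 1) = (w 0 (0, 0) + w 0 (1, 1)) / 2 - (w 0 (1, 0) + w 0 (0, 1)) / 4"
    "w 1 (2, 0) = w 0 (1, 0) / 2"
    "w 1 (2, 1) = (w 0 (1, 0) + w 0 (1, 1)) / 2 - (w 0 (2, 1) + w 0 (0, 0)) / 4"
    using T0[of 0 "-1"] T0[of 0 0] T0[of 1 0] by simp_all
  have w2: "w 2 (1, -1) = (w 1 (0, -1) + w 1 (1, 0)) / 2 - (w 1 (1, -1) + w 1 (0, 0)) / 4"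
    "w 2 (1, 0) = (w 1 (0, 0) + w 1 (1, 0)) / 2 - (w 1 (1, 1) + w 1 (0, -1)) / 4"
    "w 2 (2, -1) = (w 1 (1, -1) + w 1 (1, 0)) / 2 - (w 1 (2, 0) + w 1 (0, -1)) / 4"
    "w 2 (2, 0) = w 1 (1, 0) / 2"
    "w 2 (2, 1) = (w 1 (1, 0) + w 1 (1, 1)) / 2 - (w 1 (2, 1) + w 1 (0, 0)) / 4"
    "w 2 (3, 0) = (w 1 (1, 0) + w 1 (2, 0)) / 2 - (w 1 (2, 1) + w 1 (1, -1)) / 4"
    "w 2 (3, 1) = (w 1 (1, 0) + w 1 (2, 1)) / 2 - (w 1 (2, 0) + w 1 (1, 1)) / 4"
    using T1[of 0 "-1"] T1[of 0 0] T1[of 1 "-1"] T1[of 1 0] by simp_all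
  have w3: "w 3 (5, 0) = (w 2 (2, 0) + w 2 (3, 0)) / 2 - (w 2 (3, 1) + w 2 (2, -1)) / 4"
    "w 3 (3, 0) = (w 2 (1, 0) + w 2 (2, 0)) / 2 - (w 2 (2, 1) + w 2 (1, -1)) / 4"
    "w 3 (5, 1) = (w 2 (2, 0) + w 2 (3, 1)) / 2 - (w 2 (3, 0) + w 2 (2, 1)) / 4"
    "w 3 (4, 1) = (w 2 (2, 0) + w 2 (2, 1)) / 2 - (w 2 (3, 1) + w 2 (1, 0)) / 4"
    "w 3 (3, -1) = (w 2 (1, -1) + w 2 (2, 0)) / 2 - (w 2 (2, -1) + w 2 (1, 0)) / 4"
    "w 3 (4, -1) = (w 2 (2, -1) + w 2 (2, 0)) / 2 - (w 2 (3, 0) + w 2 (1, -1)) / 4"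
    using T2[of 1 "-1"] T2[of 1 0] T2[of 2 "-1"] T2[of 2 0] by simp_all
  have c: "w 0 k \<le> C" "- w 0 k \<le> C" for k
    using C[of k] by linarith+
  \<comment> \<open>The six neighbours of (4, 0) are expressed through level 0; each bound is the
    sum of the absolute coefficients, 52/64 on the axis and 36/64 otherwise.\<close>
  have eq: "w 3 (5, 0) = 5/16 * w 0 (0, 0) + 1/32 * w 0 (1, 0) - 5/32 * w 0 (0, -1) - 5/32 * w 0 (1, 1) + 1/16 * w 0 (1, -1) + 1/16 * w 0 (2, 1) - 1/64 * w 0 (-1, -1) - 1/64 * w 0 (0, 1)"
    unfolding w3 w2 w1 by (simp add: field_simps)
  show "\<bar>w 3 (5, 0)\<bar> \<le> 13 / 16 * C"
    unfolding eq by (intro abs_leI; use c[of "(0, 0)"] c[of "(1, 0)"] c[of "(0, -1)"] c[of "(1, 1)"] c[of "(1, -1)"] c[of "(2, 1)"] c[of "(-1, -1)"] c[of "(0, 1)"] in linarith)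
  have eq: "w 3 (3, 0) = 1/32 * w 0 (0, 0) + 5/16 * w 0 (1, 0) - 5/32 * w 0 (0, -1) - 5/32 * w 0 (1, 1) + 1/16 * w 0 (-1, -1) + 1/16 * w 0 (0, 1) - 1/64 * w 0 (1, -1) - 1/64 * w 0 (2, 1)"
    unfolding w3 w2 w1 by (simp add: field_simps)
  show "\<bar>w 3 (3, 0)\<bar> \<le> 13 / 16 * C"
    unfolding eq by (intro abs_leI; use c[of "(0, 0)"] c[of "(1, 0)"] c[of "(0, -1)"] c[of "(1, 1)"] c[of "(-1, -1)"] c[of "(0, 1)"] c[of "(1, -1)"] c[of "(2, 1)"] in linarith)
  have eq: "w 3 (5, 1) = - 5/64 * w 0 (0, 0) + 9/32 * w 0 (1, 0) - 1/32 * w 0 (0, -1) - 3/32 * w 0 (2, 1) + 1/16 * w 0 (0, 1) - 1/64 * w 0 (1, -1)"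
    unfolding w3 w2 w1 by (simp add: field_simps)
  show "\<bar>w 3 (5, 1)\<bar> \<le> 9 / 16 * C"
    unfolding eq by (intro abs_leI; use c[of "(0, 0)"] c[of "(1, 0)"] c[of "(0, -1)"] c[of "(2, 1)"] c[of "(0, 1)"] c[of "(1, -1)"] in linarith)
  have eq: "w 3 (4, 1) = 9/32 * w 0 (0, 0) - 5/64 * w 0 (1, 0) - 1/32 * w 0 (0, -1) - 3/32 * w 0 (0, 1) + 1/16 * w 0 (2, 1) - 1/64 * w 0 (-1, -1)"
    unfolding w3 w2 w1 by (simp add: field_simps)
  show "\<bar>w 3 (4, 1)\<bar> \<le> 9 / 16 * C"
    unfolding eq by (intro abs_leI; use c[of "(0, 0)"] c[of "(1, 0)"] c[of "(0, -1)"] c[of "(0, 1)"] c[of "(2, 1)"] c[of "(-1, -1)"] in linarith)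
  have eq: "w 3 (3, -1) = 9/32 * w 0 (0, 0) - 3/32 * w 0 (-1, -1) - 1/32 * w 0 (1, 1) + 1/16 * w 0 (1, -1) - 5/64 * w 0 (1, 0) - 1/64 * w 0 (0, 1)"
    unfolding w3 w2 w1 by (simp add: field_simps)
  show "\<bar>w 3 (3, -1)\<bar> \<le> 9 / 16 * C"
    unfolding eq by (intro abs_leI; use c[of "(0, 0)"] c[of "(-1, -1)"] c[of "(1, 1)"] c[of "(1, -1)"] c[of "(1, 0)"] c[of "(0, 1)"] in linarith)
  have eq: "w 3 (4, -1) = 9/32 * w 0 (1, 0) - 3/32 * w 0 (1, -1) - 1/32 * w 0 (1, 1) + 1/16 * w 0 (-1, -1) - 5/64 * w 0 (0, 0) - 1/64 * w 0 (2, 1)"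
    unfolding w3 w2 w1 by (simp add: field_simps)
  show "\<bar>w 3 (4, -1)\<bar> \<le> 9 / 16 * C"
    unfolding eq by (intro abs_leI; use c[of "(1, 0)"] c[of "(1, -1)"] c[of "(1, 1)"] c[of "(-1, -1)"] c[of "(0, 0)"] c[of "(2, 1)"] in linarith)
qed

text \<open>The ring around a vertex created in the first step obeys the original bound again from
  two steps after its creation on, because its centre has decayed by then.\<close>

lemma tscheme_new_vertex_ring:
  assumes T: "\<And>n. tscheme (w n) (w (Suc n))" and C: "\<And>k. \<bar>w 0 k\<bar> \<le> C" "\<bar>w 1 (1, 0)\<bar> \<le> C"
    and t: "t \<ge> 2" and e: "e \<in> hexagon"
  shows "\<bar>w (Suc t) (e + (2 ^ t, 0))\<bar> \<le> C"
proof -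
  \<comment> \<open>The data recentred at the new vertex, counted from the level of its
    creation.\<close>
  define v where "v t = (\<lambda>k. w (Suc t) (k + (2 ^ t, 0)))" for t
  have v: "tscheme (v t) (v (Suc t))" for t
    using tscheme_shift[OF T[of "Suc t"], of "(2 ^ t, 0)"] by (simp add: v_def dil_def)
  have C0: "C \<ge> 0" using C(1)[of "(0, 0)"] by linarith
  have vv: "v 0 (0, 0) = w 1 (1, 0)" by (simp add: v_def)
  have "v (Suc t) (0, 0) = v t (0, 0) / 2" for t
    using v[of t, unfolded tscheme_def, rule_format, of 0 0] by simp
  from this[of 0] this[of 1] this[of 2]
  have v2: "\<bar>v 2 (0, 0)\<bar> \<le> C / 4" and v3: "\<bar>v 3 (0, 0)\<bar> \<le> C / 8"
    using C(2) vv by (simp_all add: numeral_eq_Suc)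
  have w3: "v 2 k = w 3 (k + (4, 0))" for k
    by (simp add: v_def numeral_eq_Suc)
  have r2: "\<bar>v 2 (1, 0)\<bar> \<le> 13 / 16 * C" "\<bar>v 2 (-1, 0)\<bar> \<le> 13 / 16 * C"
    "\<bar>v 2 (1, 1)\<bar> \<le> 9 / 16 * C" "\<bar>v 2 (0, 1)\<bar> \<le> 9 / 16 * C"
    "\<bar>v 2 (-1, -1)\<bar> \<le> 9 / 16 * C" "\<bar>v 2 (0, -1)\<bar> \<le> 9 / 16 * C"
    using tscheme_new_vertex[OF T C(1)] by (simp_all add: w3)
  \<comment> \<open>Iterating from level 2 would only give 13/16 + 1/4 > 1. One more step keeps
    13/16, as (1/4 + 13/16) / 2 + (9/16 + 9/16) / 4 = 13/16 in the worst case, while the centre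
    drops to 1/8; the total is then 15/16.\<close>
  have r3: "\<bar>v 3 e\<bar> \<le> 13 / 16 * C" if "e \<in> hexagon" for e
  proof -
    have v3: "tscheme (v 2) (v 3)" using v[of 2] by simp
    have le: "r \<le> 13 / 16 * C" if "r \<le> s" "s \<le> 13 / 16 * C" for r s
      using that by linarith
    show ?thesis
      using that unfolding hexagon_def
      by (elim insertE emptyE; hypsubst)
        (unfold tscheme_hexagon[OF v3], (rule le, (rule abs_tscheme_le[OF v2]; rule r2), use C0 in simp)+)
  qed
  have "\<bar>v t e\<bar> \<le> C"
  proof (cases "t = 2")
    case True
    have "\<bar>v 2 e\<bar> \<le> C" using e r2 C0 unfolding hexagon_def by auto
    then show ?thesis using True by simp
  next
    case False
    then obtain s where s: "t = 3 + s" using t by (metis Suc_leI add.commute le_Suc_ex le_neq_implies_less numeral_2_eq_2 numeral_3_eq_3)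
    have "\<bar>v (3 + s) e\<bar> \<le> 13 / 16 * C + C / 8"
      by (rule tscheme_ring_iterate[of "\<lambda>s. v (3 + s)"]) (use v[of "3 + _"] r3 v3 e in \<open>simp_all\<close>)
    then show ?thesis using C0 s by simp
  qed
  then show ?thesis by (simp add: v_def)
qed

section \<open>Position of a vertex relative to the coarser meshes\<close>

lemma hexagon_rot: "e \<in> hexagon \<Longrightarrow> \<exists>i. e = (rot ^^ i) (1, 0)"
proof -
  have "(rot ^^ 0) (1, 0) = (1, 0)" "(rot ^^ 1) (1, 0) = (1, 1)" "(rot ^^ 2) (1, 0) = (0, 1)"
    "(rot ^^ 3) (1, 0) = (-1, 0)" "(rot ^^ 4) (1, 0) = (-1, -1)" "(rot ^^ 5) (1, 0) = (0, -1)"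
    by (simp_all add: rot_def eval_nat_numeral)
  then show "e \<in> hexagon \<Longrightarrow> ?thesis"
    unfolding hexagon_def by (metis empty_iff insert_iff)
qed

text \<open>Seen from the mesh two levels before, a vertex belongs to the previous mesh, or lies on
  an edge joining midpoints of coarse edges (a rotation of the case of
  \<open>tscheme_inner_edge\<close>), or is next to a coarse vertex.\<close>

lemma mod_4_cases:
  fixes k :: "int \<times> int"
  obtains p where "k = dil 2 p"
  | q i where "k = (rot ^^ i) (2, 1) + dil 4 q"
  | q e where "e \<in> hexagon" "k = e + dil 4 q"
proof -
  have rots: "(rot ^^ 0) (2, 1) = (2, 1)" "(rot ^^ 1) (2, 1) = (1, 2)" "(rot ^^ 2) (2, 1) = (-1, 1)"
    "(rot ^^ 3) (2, 1) = (-2, -1)" "(rot ^^ 4) (2, 1) = (-1, -2)" "(rot ^^ 5) (2, 1) = (1, -1)"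
    by (simp_all add: rot_def eval_nat_numeral)
  have "(\<exists>p. k = dil 2 p) \<or> (\<exists>q. \<exists>e\<in>hexagon. k = e + dil 4 q) \<or> (\<exists>q i. k = (rot ^^ i) (2, 1) + dil 4 q)"
  proof (cases k rule: int_parity_cases)
    case (1 m n)
    then have "k = dil 2 (m, n)" by (simp add: dil_def)
    then show ?thesis by blast
  next
    case (2 m n)
    show ?thesis
    proof (cases "(m, n)" rule: int_parity_cases)
      case A: (1 a b)
      have "k = (1, 0) + dil 4 (a, b)" using 2 A by (simp add: dil_def)
      then show ?thesis unfolding hexagon_def by blast
    next
      case A: (2 a b)
      have "k = (-1, 0) + dil 4 (a + 1, b)" using 2 A by (simp add: dil_def)
      then show ?thesis unfolding hexagon_def by blast
    next
      case A: (3 a b)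
      have "k = (1, 2) + dil 4 (a, b)" using 2 A by (simp add: dil_def)
      then show ?thesis using rots by metis
    next
      case A: (4 a b)
      have "k = (-1, -2) + dil 4 (a + 1, b + 1)" using 2 A by (simp add: dil_def)
      then show ?thesis using rots by metis
    qed
  next
    case (3 m n)
    show ?thesis
    proof (cases "(m, n)" rule: int_parity_cases)
      case A: (1 a b)
      have "k = (0, 1) + dil 4 (a, b)" using 3 A by (simp add: dil_def)
      then show ?thesis unfolding hexagon_def by blast
    next
      case A: (2 a b)
      have "k = (2, 1) + dil 4 (a, b)" using 3 A by (simp add: dil_def)
      then show ?thesis using rots by metis
    next
      case A: (3 a b)
      have "k = (0, -1) + dil 4 (a, b + 1)" using 3 A by (simp add: dil_def)
      then show ?thesis unfolding hexagon_def by blast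
    next
      case A: (4 a b)
      have "k = (-2, -1) + dil 4 (a + 1, b + 1)" using 3 A by (simp add: dil_def)
      then show ?thesis using rots by metis
    qed
  next
    case (4 m n)
    show ?thesis
    proof (cases "(m, n)" rule: int_parity_cases)
      case A: (1 a b)
      have "k = (1, 1) + dil 4 (a, b)" using 4 A by (simp add: dil_def)
      then show ?thesis unfolding hexagon_def by blast
    next
      case A: (2 a b)
      have "k = (-1, 1) + dil 4 (a + 1, b)" using 4 A by (simp add: dil_def)
      then show ?thesis using rots by metis
    next
      case A: (3 a b)
      have "k = (1, -1) + dil 4 (a, b + 1)" using 4 A by (simp add: dil_def)
      then show ?thesis using rots by metis
    next
      case A: (4 a b)
      have "k = (-1, -1) + dil 4 (a + 1, b + 1)" using 4 A by (simp add: dil_def)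
      then show ?thesis unfolding hexagon_def by blast
    qed
  qed
  then show ?thesis using that by blast
qed

text \<open>Halve \<open>q\<close> as often as possible, at most \<open>j\<close> times. As a vertex
  of level \<open>j\<close>, \<open>q\<close> was either new at level \<open>j - s\<close> or is
  already present at level 0; an odd vector is congruent modulo 2 to a rotation of (1, 0).\<close>

lemma odd_part:
  fixes q :: "int \<times> int"
  shows "(\<exists>s a i. s < j \<and> q = dil (2 ^ s) ((rot ^^ i) (1, 0) + dil 2 a)) \<or> (\<exists>v. q = dil (2 ^ j) v)"
proof (induction j)
  case 0
  have "q = dil (2 ^ 0) q" by (simp add: dil_def)
  then show ?case by blast
next
  case (Suc j)
  show ?case
  proof (cases "\<exists>s a i. s < j \<and> q = dil (2 ^ s) ((rot ^^ i) (1, 0) + dil 2 a)")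
    case True
    then show ?thesis using less_SucI by blast
  next
    case False
    then obtain v where v: "q = dil (2 ^ j) v" using Suc by blast
    have "(\<exists>p. v = dil 2 p) \<or> (\<exists>a e. e \<in> hexagon \<and> v = e + dil 2 a)"
    proof (cases v rule: int_parity_cases)
      case (1 m n)
      then have "v = dil 2 (m, n)" by (simp add: dil_def)
      then show ?thesis by blast
    next
      case (2 m n)
      then have "v = (1, 0) + dil 2 (m, n)" by (simp add: dil_def)
      then show ?thesis unfolding hexagon_def by blast
    next
      case (3 m n)
      then have "v = (0, 1) + dil 2 (m, n)" by (simp add: dil_def)
      then show ?thesis unfolding hexagon_def by blast
    next
      case (4 m n)
      then have "v = (1, 1) + dil 2 (m, n)" by (simp add: dil_def)
      then show ?thesis unfolding hexagon_def by blast
    qed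
    then show ?thesis
    proof
      assume "\<exists>p. v = dil 2 p"
      then obtain p where "v = dil 2 p" by blast
      then have "q = dil (2 ^ Suc j) p" using v by (simp add: dil_dil mult.commute)
      then show ?thesis by blast
    next
      assume "\<exists>a e. e \<in> hexagon \<and> v = e + dil 2 a"
      then obtain a i where "v = (rot ^^ i) (1, 0) + dil 2 a" using hexagon_rot by blast
      then show ?thesis using v by blast
    qed
  qed
qed

text \<open>
  Induction on the level. Only the vertices next to a vertex of the mesh two levels before are not
  covered by a contraction; such a point is followed back to the level at which its
  neighbouring vertex was new, or to level \<open>0\<close>.
\<close>

theorem tscheme_bounded:
  assumes T: "\<And>n. tscheme (w n) (w (Suc n))" and B: "\<And>k. \<bar>w 0 k\<bar> \<le> B"
  shows "\<bar>w n k\<bar> \<le> 2 * B"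
proof (induction n arbitrary: k rule: less_induct)
  case (less n)
  have B0: "B \<ge> 0" using B[of "(0, 0)"] by linarith
  have even: "w (Suc m) (dil 2 p) = w m p / 2" for m p
    using T[of m, unfolded tscheme_def, rule_format, of "fst p" "snd p"] by (simp add: dil_def split_beta)
  \<comment> \<open>Level 1 has no mesh two levels before it; here the crude factor 3/2
    suffices.\<close>
  have first: "\<bar>w 1 k\<bar> \<le> 2 * B" for k
  proof -
    have *: "\<bar>(x + y) / 2 - (z + t) / 4\<bar> \<le> 2 * B"
      if "\<bar>x\<bar> \<le> B" "\<bar>y\<bar> \<le> B" "\<bar>z\<bar> \<le> B" "\<bar>t\<bar> \<le> B" for x y z t
      using abs_tscheme_le[OF that] B0 by simp
    note S = T[of 0, unfolded tscheme_def, rule_format]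
    show ?thesis
    proof (cases k rule: int_parity_cases)
      case (1 m n)
      then show ?thesis using S[of m n] B[of "(m, n)"] B0 by auto
    next
      case (2 m n)
      then show ?thesis using S[of m n] *[OF B B B B] by simp
    next
      case (3 m n)
      then show ?thesis using S[of m n] *[OF B B B B] by simp
    next
      case (4 m n)
      then show ?thesis using S[of m n] *[OF B B B B] by simp
    qed
  qed
  consider "n = 0" | "n = 1" | j where "n = Suc (Suc j)"
    by (metis One_nat_def not0_implies_Suc)
  then show ?case
  proof cases
    case 1
    then show ?thesis using B[of k] B0 by simp
  next
    case 2
    then show ?thesis using first by simp
  next
    case (3 j)
    show ?thesis
    proof (cases k rule: mod_4_cases)
      case (1 p)
      then show ?thesis using less.IH[of "Suc j" p] 3 even[of "Suc j" p] B0 by simp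
    next
      case (2 q i)
      \<comment> \<open>Translation and rotation bring the vertex to (2, 1), two levels above
        \<open>j\<close>.\<close>
      define v where "v s = (\<lambda>k. w (j + s) ((rot ^^ i) k + dil (2 ^ s) q))" for s
      have v: "tscheme (v s) (v (Suc s))" for s
        using tscheme_rot_power[OF tscheme_shift[OF T[of "j + s"], of "dil (2 ^ s) q"], of i]
        by (simp add: v_def dil_dil)
      have "\<bar>v 2 (2, 1)\<bar> \<le> 3 / 4 * (2 * B)"
      proof (rule tscheme_inner_edge)
        show "tscheme (v 0) (v 1)" "tscheme (v 1) (v 2)" using v[of 0] v[of 1] by (simp_all add: eval_nat_numeral)
        show "\<bar>v 0 k\<bar> \<le> 2 * B" for k using less.IH[of j] 3 by (simp add: v_def)
      qed
      then show ?thesis using 2 3 B0 by (simp add: v_def)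
    next
      case (3 q e)
      note k = this and n = \<open>n = Suc (Suc j)\<close>
      from odd_part[of j q] show ?thesis
      proof (elim disjE exE conjE)
        fix s a i
        assume s: "s < j" and q: "q = dil (2 ^ s) ((rot ^^ i) (1, 0) + dil 2 a)"
        \<comment> \<open>Level \<open>m\<close> is the last one before \<open>q\<close> appears; in
          the coordinates of \<open>v\<close> it appears at level 1 as (1, 0). The induction
          hypothesis is used at levels \<open>m\<close> and \<open>m + 1\<close>.\<close>
        define m where "m = j - s - 1"
        have j: "j = Suc (m + s)" using s by (simp add: m_def)
        define v where "v t = (\<lambda>k. w (m + t) ((rot ^^ i) k + dil (2 ^ t) a))" for t
        have v: "tscheme (v t) (v (Suc t))" for t
          using tscheme_rot_power[OF tscheme_shift[OF T[of "m + t"], of "dil (2 ^ t) a"], of i]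
          by (simp add: v_def dil_dil)
        obtain e' where e': "e' \<in> hexagon" "e = (rot ^^ i) e'"
          using rot_power_hexagon[of i] k(1) by blast
        have "\<bar>v (Suc (s + 2)) (e' + (2 ^ (s + 2), 0))\<bar> \<le> 2 * B"
          by (rule tscheme_new_vertex_ring[of v, OF v _ _ _ e'(1)])
            (use less.IH[of m] less.IH[of "m + 1"] n j in \<open>simp_all add: v_def\<close>)
        moreover have "k = (rot ^^ i) (e' + (2 ^ (s + 2), 0)) + dil (2 ^ Suc (s + 2)) a"
        proof -
          have "(2 ^ (s + 2), 0) = dil (2 ^ (s + 2)) (1, 0)" by (simp add: dil_def)
          then have "(rot ^^ i) (e' + (2 ^ (s + 2), 0)) = e + dil (2 ^ (s + 2)) ((rot ^^ i) (1, 0))"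
            by (simp only: rot_power_add rot_power_dil e')
          then show ?thesis using k(2) q by (simp add: dil_add dil_dil algebra_simps)
        qed
        ultimately show ?thesis using n j by (simp add: v_def)
      next
        fix a
        assume q: "q = dil (2 ^ j) a"
        \<comment> \<open>Around a vertex of level 0 the ring is followed from the initial data;
          ring and centre contribute \<open>B\<close> each, which is the origin of the factor
          2.\<close>
        define v where "v t = (\<lambda>k. w t (k + dil (2 ^ t) a))" for t
        have v: "tscheme (v t) (v (Suc t))" for t
          using tscheme_shift[OF T[of t], of "dil (2 ^ t) a"] by (simp add: v_def dil_dil)
        have "\<bar>v n e\<bar> \<le> B + B"
          by (rule tscheme_ring_iterate[of v, OF v]) (use B k in \<open>simp_all add: v_def\<close>)
        then show ?thesis using k(2) q n by (simp add: v_def dil_dil)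
      qed
    qed
  qed
qed

section \<open>Second differences of the data\<close>

abbreviation bdata :: "nat \<Rightarrow> int \<times> int \<Rightarrow> real" where
  "bdata \<equiv> butterfly_data (1 / 16)"

lemma bdata_0: "bdata 0 = delta_data"
  by (simp add: butterfly_data_def)

lemma bdata_Suc: "bdata (Suc n) = step (bdata n)"
  by (simp add: butterfly_data_def)

lemma bdata_even: "bdata (Suc n) (2 * p, 2 * q) = bdata n (p, q)"
  by (simp add: bdata_Suc step_even_even)

lemma dscheme_scale:
  assumes "dscheme u u'"
  shows "dscheme (\<lambda>k. c * u k) (\<lambda>k. c * u' k)"
  unfolding dscheme_def
  by (simp add: assms[unfolded dscheme_def, rule_format]) (simp add: field_simps)?

text \<open>The layers are bounded one after the other: \<open>w\<close> by 8, then \<open>d\<close>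
  by \<open>4 + 4 * n\<close>, since it gains at most 8 / 2 per step, then \<open>u\<close>, which
  gains at most \<open>2 * n + 4\<close>.\<close>

lemma mixed_diff_bdata_le: "\<bar>mixed_diff (bdata n) k\<bar> \<le> 4 * (real n + 1)\<^sup>2 / 4 ^ n"
proof -
  define u where "u = (\<lambda>n k. 4 ^ n * mixed_diff (bdata n) k)"
  have D: "dscheme (u n) (u (Suc n))" for n
    using dscheme_scale[OF dscheme_mixed_diff, of "4 ^ n" "bdata n"]
    by (simp add: u_def bdata_Suc mult_ac)
  have u0: "\<bar>u 0 k\<bar> \<le> 2" for k
    by (cases k) (auto simp: u_def bdata_0 mixed_diff_def delta_data_def)
  have d0: "\<bar>u 0 k - u 0 k'\<bar> \<le> 4" for k k'
    using u0[of k] u0[of k'] by linarith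
  have w: "\<bar>u n (p, q) - u n (p - 1, q - 1)\<bar> \<le> 8" for n p q
    using tscheme_bounded[of "\<lambda>n (p, q). u n (p, q) - u n (p - 1, q - 1)" 4 n "(p, q)"]
      tscheme_diagonal_diff[OF D] d0 by (simp add: split_beta)
  have d: "\<bar>u n (p + 1, q) - u n (p, q)\<bar> \<le> 4 + 4 * real n" for n p q
  proof (induction n arbitrary: p q)
    case (Suc n)
    from dscheme_growth(1)[OF D w Suc.IH, of p q] show ?case by simp
  qed (use d0 in simp)
  have "\<bar>u n k\<bar> \<le> 4 * (real n + 1)\<^sup>2" for k
  proof (induction n arbitrary: k)
    case (Suc n)
    from dscheme_growth(2)[OF D w d Suc.IH, of k] show ?case
      by (simp add: power2_eq_square field_simps)
  qed (use u0 in \<open>simp add: order.trans[OF u0]\<close>)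
  then show ?thesis by (simp add: u_def field_simps abs_mult)
qed

section \<open>Rotation symmetry of the data and its consequences\<close>

lemma step_rot: "step (\<lambda>k. f (rot k)) k = step f (rot k)"
proof -
  show ?thesis
  proof (cases k rule: int_parity_cases)
    case (1 m n)
    then have "rot k = (2 * (m - n), 2 * m)" by (simp add: rot_def)
    then show ?thesis unfolding 1
      by (simp only: step_even_even) (simp add: rot_def)
  next
    case (2 m n)
    then have "rot k = (2 * (m - n) + 1, 2 * m + 1)" by (simp add: rot_def)
    then show ?thesis unfolding 2
      by (simp only: step_odd_odd step_odd_even) (simp add: rot_def algebra_simps)
  next
    case (3 m n)
    then have "rot k = (2 * (m - n - 1) + 1, 2 * m)" by (simp add: rot_def)
    then show ?thesis unfolding 3
      by (simp only: step_even_odd step_odd_even) (simp add: rot_def algebra_simps)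
  next
    case (4 m n)
    then have "rot k = (2 * (m - n), 2 * m + 1)" by (simp add: rot_def)
    then show ?thesis unfolding 4
      by (simp only: step_even_odd step_odd_odd) (simp add: rot_def algebra_simps)
  qed
qed

lemma bdata_rot: "bdata n (rot k) = bdata n k"
proof (induction n arbitrary: k)
  case 0
  then show ?case by (cases k) (auto simp: bdata_0 rot_def delta_data_def)
next
  case (Suc n)
  have "(\<lambda>k. bdata n (rot k)) = bdata n" using Suc by auto
  then show ?case using step_rot[of "bdata n" k] by (simp add: bdata_Suc)
qed

text \<open>Minus the second difference is the sum of the mixed difference at \<open>(p, q)\<close>
  and the alternating sum over the parallelogram \<open>(p - 1, q)\<close>, \<open>(p, q)\<close>,
  \<open>(p + 1, q + 1)\<close>, \<open>(p, q + 1)\<close>. Two rotations turn the latter into a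
  unit square, hence into a mixed difference.\<close>

lemma bdata_second_diff_1:
  "\<bar>bdata n (p + 1, q) - 2 * bdata n (p, q) + bdata n (p - 1, q)\<bar> \<le> 8 * (real n + 1)\<^sup>2 / 4 ^ n"
proof -
  let ?f = "bdata n"
  have *: "?f (a, b) = ?f (p, q)" if "a = - q" "b = p - q" for a b p q
    using bdata_rot[of n "rot (p, q)"] bdata_rot[of n "(p, q)"] that by (simp add: rot_def)
  have "?f (- q, p - q) = ?f (p, q)" "?f (- q, p - 1 - q) = ?f (p - 1, q)"
    "?f (- q - 1, p - q - 1) = ?f (p, q + 1)" "?f (- q - 1, p - q) = ?f (p + 1, q + 1)"
    by (intro *; simp)+
  then show ?thesis using mixed_diff_bdata_le[of n "(p, q)"]
    mixed_diff_bdata_le[of n "(- q - 1, p - q - 1)"] by (simp add: mixed_diff_def algebra_simps)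
qed

lemma bdata_second_diff_2:
  "\<bar>bdata n (p, q + 1) - 2 * bdata n (p, q) + bdata n (p, q - 1)\<bar> \<le> 8 * (real n + 1)\<^sup>2 / 4 ^ n"
proof -
  let ?f = "bdata n"
  have "?f (p - q, p) = ?f (p, q)" "?f (p + 1 - q, p + 1) = ?f (p + 1, q)"
    "?f (p - q + 1, p) = ?f (p, q - 1)" "?f (p - q, p + 1) = ?f (p + 1, q + 1)"
    using bdata_rot[of n "(p, q)"] bdata_rot[of n "(p + 1, q)"] bdata_rot[of n "(p, q - 1)"]
      bdata_rot[of n "(p + 1, q + 1)"] by (simp_all add: rot_def algebra_simps)
  then show ?thesis using mixed_diff_bdata_le[of n "(p, q)"]
    mixed_diff_bdata_le[of n "(p - q, p)"] by (simp add: mixed_diff_def algebra_simps)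
qed

text \<open>Up to rotation these are all the vertices within two edges of the origin, and their new
  values depend only on their old ones; the closed forms solve this recursion.\<close>

lemma bdata_at_origin:
  "bdata n (0, 0) = 1"
  "bdata n (1, 0) = 1 - (1 + 7 / 8 * real n + (real n)\<^sup>2 / 8) / 4 ^ n"
  "bdata n (2, 1) = 1 - (1 + 17 / 8 * real n + 3 / 8 * (real n)\<^sup>2) / 4 ^ n"
  "bdata n (2, 0) = 1 - (1 + 5 / 2 * real n + (real n)\<^sup>2 / 2) / 4 ^ n"
proof (induction n)
  case 0
  { case 1 show ?case by (simp add: bdata_0 delta_data_def) }
  { case 2 show ?case by (simp add: bdata_0 delta_data_def) }
  { case 3 show ?case by (simp add: bdata_0 delta_data_def) }
  { case 4 show ?case by (simp add: bdata_0 delta_data_def) }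
next
  case (Suc n)
  let ?f = "bdata n"
  have rots: "?f (1, 1) = ?f (1, 0)" "?f (0, 1) = ?f (1, 0)" "?f (-1, 0) = ?f (1, 0)"
    "?f (-1, -1) = ?f (1, 0)" "?f (0, -1) = ?f (1, 0)" "?f (1, -1) = ?f (2, 1)" "?f (2, 2) = ?f (2, 0)"
    using bdata_rot[of n "(1, 0)"] bdata_rot[of n "(1, 1)"] bdata_rot[of n "(0, 1)"] bdata_rot[of n "(-1, 0)"]
      bdata_rot[of n "(-1, -1)"] bdata_rot[of n "(1, -1)"] bdata_rot[of n "(2, 0)"]
    by (simp_all add: rot_def)
  { case 1 show ?case using step_even_even[of ?f 0 0] Suc(1) by (simp add: bdata_Suc) }
  have steps: "step ?f (1, 0) = (?f (0, 0) + ?f (1, 0)) / 2 + (?f (1, 1) + ?f (0, -1)) / 8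
      - (?f (0, 1) + ?f (2, 1) + ?f (-1, -1) + ?f (1, -1)) / 16"
    "step ?f (2, 1) = (?f (1, 0) + ?f (1, 1)) / 2 + (?f (2, 1) + ?f (0, 0)) / 8
      - (?f (2, 0) + ?f (2, 2) + ?f (0, -1) + ?f (0, 1)) / 16"
    "step ?f (2, 0) = ?f (1, 0)"
    using step_odd_even[of ?f 0 0] step_even_odd[of ?f 1 0] step_even_even[of ?f 1 0] by simp_all
  { case 2 show ?case unfolding bdata_Suc steps rots Suc by (simp add: field_simps power2_eq_square) }
  { case 3 show ?case unfolding bdata_Suc steps rots Suc by (simp add: field_simps power2_eq_square) }
  { case 4 show ?case unfolding bdata_Suc steps rots Suc by (simp add: field_simps power2_eq_square) }
qed

section \<open>Limits of refined grid functions\<close>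

definition rate :: "nat \<Rightarrow> real" where
  "rate n = (real n + 1)\<^sup>2 / 2 ^ n"

text \<open>The closed form of the sum of \<open>rate k\<close> over all \<open>k \<ge> n\<close>:
  it telescopes to \<open>rate\<close> and tends to 0. Its value at 0 is 12.\<close>

definition rate_tail :: "nat \<Rightarrow> real" where
  "rate_tail n = (2 * (real n)\<^sup>2 + 8 * real n + 12) / 2 ^ n"

lemma rate_tail_diff: "rate_tail n - rate_tail (Suc n) = rate n"
  by (simp add: rate_tail_def rate_def field_simps power2_eq_square)

lemma rate_pos: "rate n > 0"
  by (simp add: rate_def add_pos_nonneg)

lemma rate_tail_pos: "rate_tail n > 0"
  by (simp add: rate_tail_def add_nonneg_pos)

lemma rate_Suc_le: "rate (Suc n) \<le> 2 * rate n"
proof -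
  have "(real n + 2)\<^sup>2 \<le> (2 * (real n + 1))\<^sup>2"
    by (intro power_mono) auto
  then show ?thesis by (simp add: rate_def field_simps power2_eq_square)
qed

lemma inverse_le_rate: "1 / 2 ^ n \<le> rate n"
  by (simp add: rate_def divide_right_mono)

lemma rate_le_rate_tail: "rate n \<le> rate_tail n"
  using rate_tail_diff[of n] rate_tail_pos[of "Suc n"] by linarith

lemma rate_tail_le_rate: "rate_tail n \<le> 12 * rate n"
  unfolding rate_def rate_tail_def by (simp add: divide_right_mono power2_eq_square algebra_simps)

lemma rate_tail_antimono: "m \<le> n \<Longrightarrow> rate_tail n \<le> rate_tail m"
proof (rule lift_Suc_antimono_le)
  show "rate_tail (Suc n) \<le> rate_tail n" for n
    using rate_tail_diff[of n] rate_pos[of n] by linarith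
qed

lemma rate_tail_tendsto: "rate_tail \<longlonglongrightarrow> 0"
  unfolding rate_tail_def by real_asymp

definition cell :: "nat \<Rightarrow> real^2 \<Rightarrow> int \<times> int" where
  "cell n x = (\<lfloor>2 ^ n * x $ 1\<rfloor>, \<lfloor>2 ^ n * x $ 2\<rfloor>)"

lemma floor_double: "\<exists>a\<in>{0, 1}. \<lfloor>2 * t\<rfloor> = 2 * \<lfloor>t :: real\<rfloor> + a"
proof -
  have "\<lfloor>2 * t\<rfloor> = 2 * \<lfloor>t\<rfloor> \<or> \<lfloor>2 * t\<rfloor> = 2 * \<lfloor>t\<rfloor> + 1" by linarith
  then show ?thesis by auto
qed

lemma cell_Suc:
  obtains a b where "a \<in> {0, 1}" "b \<in> {0, 1}"
    "cell (Suc n) x = (2 * fst (cell n x) + a, 2 * snd (cell n x) + b)"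
  using floor_double[of "2 ^ n * x $ 1"] floor_double[of "2 ^ n * x $ 2"]
  by (auto simp: cell_def mult.assoc)

text \<open>A common frame for the data and both of its divided differences. The offsets
  \<open>a\<close>, \<open>b\<close> describe the passage from a cell to one of its four subcells;
  since \<open>rate\<close> is summable, the values along the cells of a point converge.\<close>

locale grid_sequence =
  fixes F :: "nat \<Rightarrow> int \<times> int \<Rightarrow> real" and c :: real
  assumes refine: "a \<in> {0, 1} \<Longrightarrow> b \<in> {0, 1} \<Longrightarrow>
      \<bar>F (Suc n) (2 * p + a, 2 * q + b) - F n (p, q)\<bar> \<le> c * rate n"
    and move1: "\<bar>F n (p + 1, q) - F n (p, q)\<bar> \<le> c * rate n"
    and move2: "\<bar>F n (p, q + 1) - F n (p, q)\<bar> \<le> c * rate n"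
begin

lemma c_nonneg: "c \<ge> 0"
proof -
  have "0 \<le> c * rate 0" using order.trans[OF abs_ge_zero move1[of 0 0 0]] .
  then show ?thesis using rate_pos[of 0] by (simp add: zero_le_mult_iff)
qed

lemma F_cell_diff: "m \<le> n \<Longrightarrow> \<bar>F n (cell n x) - F m (cell m x)\<bar> \<le> c * (rate_tail m - rate_tail n)"
proof (induction n rule: dec_induct)
  case (step n)
  obtain a b where "a \<in> {0, 1}" "b \<in> {0, 1}"
    "cell (Suc n) x = (2 * fst (cell n x) + a, 2 * snd (cell n x) + b)"
    by (rule cell_Suc)
  then have "\<bar>F (Suc n) (cell (Suc n) x) - F n (cell n x)\<bar> \<le> c * rate n"
    using refine[of a b n "fst (cell n x)" "snd (cell n x)"] by simp
  also have "\<dots> = c * (rate_tail n - rate_tail (Suc n))"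
    by (simp add: rate_tail_diff)
  finally show ?case using step.IH by (simp add: algebra_simps)
qed simp

definition limit :: "real^2 \<Rightarrow> real" where
  "limit x = lim (\<lambda>n. F n (cell n x))"

lemma tendsto_limit: "(\<lambda>n. F n (cell n x)) \<longlonglongrightarrow> limit x"
proof -
  have "Cauchy (\<lambda>n. F n (cell n x))"
  proof (rule metric_CauchyI)
    fix e :: real assume "e > 0"
    have "(\<lambda>n. c * rate_tail n) \<longlonglongrightarrow> 0"
      using tendsto_mult[OF tendsto_const rate_tail_tendsto, of c] by simp
    then obtain N where N: "c * rate_tail N < e"
      using order_tendstoD(2)[OF _ \<open>e > 0\<close>] eventually_happens'[OF sequentially_bot] by blast
    have le: "\<bar>F n (cell n x) - F m (cell m x)\<bar> < e" if "m \<ge> N" "n \<ge> m" for m n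
    proof -
      have "c * (rate_tail m - rate_tail n) \<le> c * rate_tail N"
        using that c_nonneg rate_tail_antimono[of N m] rate_tail_pos[of n] by (intro mult_left_mono) auto
      then show ?thesis using F_cell_diff[of m n x] that N by linarith
    qed
    have "dist (F m (cell m x)) (F n (cell n x)) < e" if "m \<ge> N" "n \<ge> N" for m n
      using le[of m n] le[of n m] that by (cases "m \<le> n") (auto simp: dist_real_def abs_minus_commute)
    then show "\<exists>N. \<forall>m\<ge>N. \<forall>n\<ge>N. dist (F m (cell m x)) (F n (cell n x)) < e" by blast
  qed
  then show ?thesis
    unfolding limit_def by (simp add: Cauchy_convergent_iff convergent_LIMSEQ_iff)
qed

lemma limit_approx: "\<bar>limit x - F n (cell n x)\<bar> \<le> c * rate_tail n"
proof (rule LIMSEQ_le_const2)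
  show "(\<lambda>m. \<bar>F m (cell m x) - F n (cell n x)\<bar>) \<longlonglongrightarrow> \<bar>limit x - F n (cell n x)\<bar>"
    by (intro tendsto_intros tendsto_limit)
  have "\<bar>F m (cell m x) - F n (cell n x)\<bar> \<le> c * rate_tail n" if "m \<ge> n" for m
  proof -
    have "c * (rate_tail n - rate_tail m) \<le> c * rate_tail n"
      using c_nonneg rate_tail_pos[of m] by (intro mult_left_mono) auto
    then show ?thesis using F_cell_diff[OF that, of x] by linarith
  qed
  then show "\<exists>N. \<forall>m\<ge>N. \<bar>F m (cell m x) - F n (cell n x)\<bar> \<le> c * rate_tail n" by blast
qed

text \<open>The cells of the two points differ by at most one in each coordinate: two moves at level
  \<open>n\<close> and two approximation errors make the factor 4.\<close>

lemma limit_modulus: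
  assumes "\<bar>x $ 1 - y $ 1\<bar> \<le> 1 / 2 ^ n" "\<bar>x $ 2 - y $ 2\<bar> \<le> 1 / 2 ^ n"
  shows "\<bar>limit x - limit y\<bar> \<le> 4 * c * rate_tail n"
proof -
  have near: "\<lfloor>2 ^ n * s\<rfloor> = \<lfloor>2 ^ n * t\<rfloor> \<or> \<lfloor>2 ^ n * s\<rfloor> = \<lfloor>2 ^ n * t\<rfloor> + 1 \<or> \<lfloor>2 ^ n * t\<rfloor> = \<lfloor>2 ^ n * s\<rfloor> + 1"
    if "\<bar>s - t\<bar> \<le> 1 / 2 ^ n" for s t :: real
  proof -
    have "\<bar>2 ^ n * s - 2 ^ n * t\<bar> \<le> 1"
      using that by (simp add: abs_le_iff field_simps)
    then show ?thesis by linarith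
  qed
  obtain p q p' q' where c: "cell n x = (p, q)" "cell n y = (p', q')" by fastforce
  have "\<bar>F n (p, q) - F n (p', q)\<bar> \<le> c * rate n"
    using near[OF assms(1)] c move1[of n p q] move1[of n p' q] c_nonneg rate_pos[of n]
    by (auto simp: cell_def abs_minus_commute)
  moreover have "\<bar>F n (p', q) - F n (p', q')\<bar> \<le> c * rate n"
    using near[OF assms(2)] c move2[of n p' q] move2[of n p' q'] c_nonneg rate_pos[of n]
    by (auto simp: cell_def abs_minus_commute)
  moreover have "c * rate n \<le> c * rate_tail n"
    using c_nonneg rate_le_rate_tail by (intro mult_left_mono)
  ultimately have "\<bar>F n (cell n x) - F n (cell n y)\<bar> \<le> 2 * (c * rate_tail n)"
    unfolding c by linarith
  then show ?thesis using limit_approx[of x n] limit_approx[of y n] by linarith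
qed

lemma continuous_limit: "continuous_on UNIV limit"
proof (rule continuous_at_imp_continuous_on, intro ballI)
  fix x
  show "isCont limit x"
    unfolding continuous_at_eps_delta
  proof (intro allI impI)
    fix e :: real assume "e > 0"
    have "(\<lambda>n. 4 * c * rate_tail n) \<longlonglongrightarrow> 0"
      using tendsto_mult[OF tendsto_const rate_tail_tendsto, of "4 * c"] by simp
    then obtain N where N: "4 * c * rate_tail N < e"
      using order_tendstoD(2)[OF _ \<open>e > 0\<close>] eventually_happens'[OF sequentially_bot] by blast
    have "dist (limit y) (limit x) < e" if "dist y x < 1 / 2 ^ N" for y
      using limit_modulus[of y x N] component_le_norm_cart[of "y - x" 1]
        component_le_norm_cart[of "y - x" 2] that N
      by (simp add: dist_norm)
    then show "\<exists>d>0. \<forall>y. dist y x < d \<longrightarrow> dist (limit y) (limit x) < e"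
      by (intro exI[of _ "1 / 2 ^ N"]) auto
  qed
qed

lemma bounded_limit:
  assumes "\<And>k. \<bar>F 0 k\<bar> \<le> B"
  shows "\<bar>limit x\<bar> \<le> B + 12 * c"
  using limit_approx[of x 0] assms[of "cell 0 x"] by (simp add: rate_tail_def)

end

section \<open>Divided differences of the data\<close>

definition diff1 :: "nat \<Rightarrow> int \<times> int \<Rightarrow> real" where
  "diff1 n = (\<lambda>(p, q). 2 ^ n * (bdata n (p + 1, q) - bdata n (p, q)))"

definition diff2 :: "nat \<Rightarrow> int \<times> int \<Rightarrow> real" where
  "diff2 n = (\<lambda>(p, q). 2 ^ n * (bdata n (p, q + 1) - bdata n (p, q)))"

lemma scaled_le_rate:
  assumes "\<bar>s\<bar> \<le> x * (real n + 1)\<^sup>2 / 4 ^ n"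
  shows "\<bar>2 ^ n * s\<bar> \<le> x * rate n"
proof -
  have "\<bar>2 ^ n * s\<bar> \<le> 2 ^ n * (x * (real n + 1)\<^sup>2 / (2 ^ n * 2 ^ n))"
    using mult_left_mono[OF assms, of "2 ^ n"] by (simp add: abs_mult flip: power_mult_distrib)
  then show ?thesis by (simp add: rate_def)
qed

lemma grid_sequence_diff1: "grid_sequence diff1 16"
proof
  fix n :: nat and p q a b :: int
  note D = bdata_second_diff_1[THEN scaled_le_rate] and M = mixed_diff_bdata_le[THEN scaled_le_rate]
  show "\<bar>diff1 n (p + 1, q) - diff1 n (p, q)\<bar> \<le> 16 * rate n"
    using D[of n "p + 1" q] rate_pos[of n] by (simp add: diff1_def mixed_diff_def algebra_simps)
  show "\<bar>diff1 n (p, q + 1) - diff1 n (p, q)\<bar> \<le> 16 * rate n"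
    using M[of n "(p, q)"] rate_pos[of n] by (simp add: diff1_def mixed_diff_def algebra_simps)
  show "\<bar>diff1 (Suc n) (2 * p + a, 2 * q + b) - diff1 n (p, q)\<bar> \<le> 16 * rate n"
    if ab: "a \<in> {0, 1}" "b \<in> {0, 1}"
  proof -
    let ?f = "bdata (Suc n)"
    have old: "bdata n (p, q) = ?f (2 * p, 2 * q)" "bdata n (p + 1, q) = ?f (2 * p + 2, 2 * q)"
      using bdata_even[of n p q] bdata_even[of n "p + 1" q] by (simp_all add: algebra_simps)
    \<comment> \<open>The old quotient is the mean of the two new ones on the same line, so these
      differ from it by \<open>D'\<close> up to sign; in the row above a mixed difference is added.
      Each term is at most \<open>8 * rate n\<close>.\<close>
    define D' M0 M1 where "D' = 2 ^ n * (?f (2 * p + 2, 2 * q) - 2 * ?f (2 * p + 1, 2 * q) + ?f (2 * p, 2 * q))"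
      and "M0 = 2 ^ Suc n * mixed_diff ?f (2 * p, 2 * q)" and "M1 = 2 ^ Suc n * mixed_diff ?f (2 * p + 1, 2 * q)"
    have b: "\<bar>D'\<bar> \<le> 8 * rate n" "\<bar>M0\<bar> \<le> 8 * rate n" "\<bar>M1\<bar> \<le> 8 * rate n"
      using D[of "Suc n" "2 * p + 1" "2 * q"] M[of "Suc n" "(2 * p, 2 * q)"]
        M[of "Suc n" "(2 * p + 1, 2 * q)"] rate_Suc_le[of n]
      by (simp_all add: D'_def M0_def M1_def abs_mult algebra_simps)
    have "diff1 (Suc n) (2 * p, 2 * q) - diff1 n (p, q) = - D'"
      "diff1 (Suc n) (2 * p + 1, 2 * q) - diff1 n (p, q) = D'"
      "diff1 (Suc n) (2 * p, 2 * q + 1) - diff1 n (p, q) = - D' + M0"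
      "diff1 (Suc n) (2 * p + 1, 2 * q + 1) - diff1 n (p, q) = D' + M1"
      by (simp_all add: diff1_def old D'_def M0_def M1_def mixed_diff_def int_add_1_1) (simp_all add: algebra_simps)?
    then show ?thesis using ab b by auto
  qed
qed

lemma grid_sequence_diff2: "grid_sequence diff2 16"
proof
  fix n :: nat and p q a b :: int
  note D = bdata_second_diff_2[THEN scaled_le_rate] and M = mixed_diff_bdata_le[THEN scaled_le_rate]
  show "\<bar>diff2 n (p + 1, q) - diff2 n (p, q)\<bar> \<le> 16 * rate n"
    using M[of n "(p, q)"] rate_pos[of n] by (simp add: diff2_def mixed_diff_def algebra_simps)
  show "\<bar>diff2 n (p, q + 1) - diff2 n (p, q)\<bar> \<le> 16 * rate n"
    using D[of n p "q + 1"] rate_pos[of n] by (simp add: diff2_def mixed_diff_def algebra_simps)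
  show "\<bar>diff2 (Suc n) (2 * p + a, 2 * q + b) - diff2 n (p, q)\<bar> \<le> 16 * rate n"
    if ab: "a \<in> {0, 1}" "b \<in> {0, 1}"
  proof -
    let ?f = "bdata (Suc n)"
    have old: "bdata n (p, q) = ?f (2 * p, 2 * q)" "bdata n (p, q + 1) = ?f (2 * p, 2 * q + 2)"
      using bdata_even[of n p q] bdata_even[of n p "q + 1"] by (simp_all add: algebra_simps)
    define D' M0 M1 where "D' = 2 ^ n * (?f (2 * p, 2 * q + 2) - 2 * ?f (2 * p, 2 * q + 1) + ?f (2 * p, 2 * q))"
      and "M0 = 2 ^ Suc n * mixed_diff ?f (2 * p, 2 * q)" and "M1 = 2 ^ Suc n * mixed_diff ?f (2 * p, 2 * q + 1)"
    have b: "\<bar>D'\<bar> \<le> 8 * rate n" "\<bar>M0\<bar> \<le> 8 * rate n" "\<bar>M1\<bar> \<le> 8 * rate n"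
      using D[of "Suc n" "2 * p" "2 * q + 1"] M[of "Suc n" "(2 * p, 2 * q)"]
        M[of "Suc n" "(2 * p, 2 * q + 1)"] rate_Suc_le[of n]
      by (simp_all add: D'_def M0_def M1_def abs_mult algebra_simps)
    have "diff2 (Suc n) (2 * p, 2 * q) - diff2 n (p, q) = - D'"
      "diff2 (Suc n) (2 * p, 2 * q + 1) - diff2 n (p, q) = D'"
      "diff2 (Suc n) (2 * p + 1, 2 * q) - diff2 n (p, q) = - D' + M0"
      "diff2 (Suc n) (2 * p + 1, 2 * q + 1) - diff2 n (p, q) = D' + M1"
      by (simp_all add: diff2_def old D'_def M0_def M1_def mixed_diff_def int_add_1_1) (simp_all add: algebra_simps)?
    then show ?thesis using ab b by auto
  qed
qed

interpretation g1: grid_sequence diff1 16 by (rule grid_sequence_diff1)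
interpretation g2: grid_sequence diff2 16 by (rule grid_sequence_diff2)

text \<open>Every vertex of level \<open>n + 1\<close> is compared with its parent, the
  coordinatewise quotient by 2, and the changes telescope from
  \<open>rate_tail 0 = 12\<close>.\<close>

lemma (in grid_sequence) F_bounded:
  assumes "\<And>k. \<bar>F 0 k\<bar> \<le> B"
  shows "\<bar>F n k\<bar> \<le> B + c * (12 - rate_tail n)"
proof (induction n arbitrary: k)
  case 0
  then show ?case using assms by (simp add: rate_tail_def)
next
  case (Suc n)
  define p q a b where "p = fst k div 2" and "q = snd k div 2" and "a = fst k mod 2" and "b = snd k mod 2"
  have "k = (2 * p + a, 2 * q + b)" "a \<in> {0, 1}" "b \<in> {0, 1}"
    by (auto simp: p_def q_def a_def b_def prod_eq_iff)
  then have "\<bar>F (Suc n) k - F n (p, q)\<bar> \<le> c * (rate_tail n - rate_tail (Suc n))"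
    using refine[of a b n p q] by (simp add: rate_tail_diff)
  then show ?case using Suc.IH[of "(p, q)"] by (simp add: algebra_simps)
qed

lemma (in grid_sequence) F_uniformly_bounded:
  assumes "\<And>k. \<bar>F 0 k\<bar> \<le> B"
  shows "\<bar>F n k\<bar> \<le> B + 12 * c"
proof -
  have "c * (12 - rate_tail n) \<le> c * 12"
    using c_nonneg rate_tail_pos[of n] by (intro mult_left_mono) auto
  then show ?thesis using F_bounded[OF assms, of n k] by simp
qed

lemma diff_0_bounded: "\<bar>diff1 0 k\<bar> \<le> 1" "\<bar>diff2 0 k\<bar> \<le> 1"
  by (cases k; simp add: diff1_def diff2_def bdata_0 delta_data_def)+

lemma bdata_move:
  "\<bar>bdata n (p + 1, q) - bdata n (p, q)\<bar> \<le> 200 / 2 ^ n"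
  "\<bar>bdata n (p, q + 1) - bdata n (p, q)\<bar> \<le> 200 / 2 ^ n"
proof -
  \<comment> \<open>The divided differences are at most 193, rounded up to 200.\<close>
  have *: "\<bar>s\<bar> \<le> 200 / 2 ^ n" if "\<bar>2 ^ n * s\<bar> \<le> 1 + 12 * 16" for s :: real
    using that by (simp add: abs_mult field_simps)
  show "\<bar>bdata n (p + 1, q) - bdata n (p, q)\<bar> \<le> 200 / 2 ^ n"
    "\<bar>bdata n (p, q + 1) - bdata n (p, q)\<bar> \<le> 200 / 2 ^ n"
    using g1.F_uniformly_bounded[OF diff_0_bounded(1), of n "(p, q)"] g2.F_uniformly_bounded[OF diff_0_bounded(2), of n "(p, q)"]
    by (intro *; simp add: diff1_def diff2_def)+
qed

text \<open>The increments of the data are even of order \<open>1 / 2 ^ n\<close>; weakening this to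
  \<open>rate n\<close> lets the same frame produce \<phi> itself.\<close>

lemma grid_sequence_bdata: "grid_sequence bdata 200"
proof
  fix n :: nat and p q a b :: int
  have le: "200 / 2 ^ n \<le> 200 * rate n" using inverse_le_rate[of n] by simp
  show "\<bar>bdata n (p + 1, q) - bdata n (p, q)\<bar> \<le> 200 * rate n"
    "\<bar>bdata n (p, q + 1) - bdata n (p, q)\<bar> \<le> 200 * rate n"
    using bdata_move[of n p q] le by linarith+
  let ?f = "bdata (Suc n)"
  show "\<bar>?f (2 * p + a, 2 * q + b) - bdata n (p, q)\<bar> \<le> 200 * rate n"
    if "a \<in> {0, 1}" "b \<in> {0, 1}"
  proof -
    have "\<bar>?f (2 * p + a, 2 * q) - ?f (2 * p, 2 * q)\<bar> \<le> 200 / 2 ^ Suc n"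
      using bdata_move(1)[of "Suc n" "2 * p" "2 * q"] that by auto
    moreover have "\<bar>?f (2 * p + a, 2 * q + b) - ?f (2 * p + a, 2 * q)\<bar> \<le> 200 / 2 ^ Suc n"
      using bdata_move(2)[of "Suc n" "2 * p + a" "2 * q"] that by auto
    moreover have "200 / 2 ^ Suc n + 200 / 2 ^ Suc n = (200 / 2 ^ n :: real)" by simp
    ultimately show ?thesis using le bdata_even[of n p q] by linarith
  qed
qed

interpretation phi: grid_sequence bdata 200 by (rule grid_sequence_bdata)

section \<open>Identification of the refinable function\<close>

lemma linear_extension_approx:
  assumes L: "\<And>p q. \<bar>f (p + 1, q) - f (p, q)\<bar> \<le> L" "\<And>p q. \<bar>f (p, q + 1) - f (p, q)\<bar> \<le> L"
  shows "\<bar>linear_extension f x - f (\<lfloor>x $ 1\<rfloor>, \<lfloor>x $ 2\<rfloor>)\<bar> \<le> 2 * L"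
proof -
  define m n s t where x: "m = \<lfloor>x $ 1\<rfloor>" "n = \<lfloor>x $ 2\<rfloor>" "s = frac (x $ 1)" "t = frac (x $ 2)"
  have st: "0 \<le> s" "s \<le> 1" "0 \<le> t" "t \<le> 1"
    using frac_lt_1[of "x $ 1"] frac_lt_1[of "x $ 2"] by (simp_all add: x)
  \<comment> \<open>Here \<open>a\<close> is the larger and \<open>b\<close> the smaller fractional
    part; in either triangle the deviation from the corner value is such a sum, with weights of
    total at most one.\<close>
  have *: "\<bar>(a - b) * u + b * v\<bar> \<le> 2 * L"
    if "\<bar>u\<bar> \<le> 2 * L" "\<bar>v\<bar> \<le> 2 * L" "0 \<le> b" "b \<le> a" "a \<le> 1" for a b u v :: real
  proof -
    have "\<bar>(a - b) * u + b * v\<bar> \<le> \<bar>(a - b) * u\<bar> + \<bar>b * v\<bar>"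
      by (rule abs_triangle_ineq)
    also have "\<dots> \<le> (a - b) * (2 * L) + b * (2 * L)"
      unfolding abs_mult using that(3,4) by (intro add_mono mult_mono that(1,2)) simp_all
    also have "\<dots> = a * (2 * L)" by (simp add: algebra_simps)
    also have "\<dots> \<le> 1 * (2 * L)" using that by (intro mult_right_mono) auto
    finally show ?thesis by simp
  qed
  have d: "\<bar>f (m + 1, n) - f (m, n)\<bar> \<le> 2 * L" "\<bar>f (m, n + 1) - f (m, n)\<bar> \<le> 2 * L"
    "\<bar>f (m + 1, n + 1) - f (m, n)\<bar> \<le> 2 * L"
    using L(1)[of m n] L(2)[of m n] L(2)[of "m + 1" n] by linarith+
  show ?thesis
  proof (cases "t \<le> s")
    case True
    then have "linear_extension f x - f (m, n) =
        (s - t) * (f (m + 1, n) - f (m, n)) + t * (f (m + 1, n + 1) - f (m, n))"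
      unfolding linear_extension_def Let_def x[symmetric] by (simp add: algebra_simps)
    then show ?thesis using *[OF d(1) d(3) st(3) True st(2)] unfolding x[symmetric] by simp
  next
    case False
    then have ts: "s \<le> t" by simp
    have "linear_extension f x - f (m, n) =
        (t - s) * (f (m, n + 1) - f (m, n)) + s * (f (m + 1, n + 1) - f (m, n))"
      using False unfolding linear_extension_def Let_def x[symmetric] by (simp add: algebra_simps)
    then show ?thesis using *[OF d(2) d(3) st(1) ts st(4)] unfolding x[symmetric] by simp
  qed
qed

lemma butterfly_approx_limit: "\<bar>butterfly_approx (1 / 16) n x - phi.limit x\<bar> \<le> 600 * rate_tail n"
proof -
  have "400 / 2 ^ n \<le> 400 * rate_tail n"
    using inverse_le_rate[of n] rate_le_rate_tail[of n] by simp
  moreover have "\<bar>butterfly_approx (1 / 16) n x - bdata n (cell n x)\<bar> \<le> 2 * (200 / 2 ^ n)"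
    using linear_extension_approx[OF bdata_move, of n "2 ^ n *\<^sub>R x"]
    by (simp add: butterfly_approx_def cell_def)
  ultimately show ?thesis using phi.limit_approx[of x n] by linarith
qed

lemma refinable_function_eq: "refinable_function (1 / 16) = phi.limit"
  unfolding refinable_function_def
proof (rule the_equality)
  have "(\<lambda>n. 600 * rate_tail n) \<longlonglongrightarrow> 0"
    using tendsto_mult[OF tendsto_const rate_tail_tendsto, of 600] by simp
  note lim = this
  show *: "uniform_limit UNIV (butterfly_approx (1 / 16)) phi.limit sequentially"
    unfolding uniform_limit_iff
  proof (intro allI impI)
    fix e :: real assume "e > 0"
    show "\<forall>\<^sub>F n in sequentially. \<forall>x\<in>UNIV. dist (butterfly_approx (1 / 16) n x) (phi.limit x) < e"
      using order_tendstoD(2)[OF lim \<open>e > 0\<close>]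
    proof eventually_elim
      case (elim n)
      then show ?case
        using order.strict_trans1[OF butterfly_approx_limit elim] by (simp add: dist_real_def)
    qed
  qed
  fix \<phi> assume "uniform_limit UNIV (butterfly_approx (1 / 16)) \<phi> sequentially"
  then have "(\<lambda>n. butterfly_approx (1 / 16) n x) \<longlonglongrightarrow> \<phi> x" for x
    by (rule tendsto_uniform_limitI) simp
  moreover have "(\<lambda>n. butterfly_approx (1 / 16) n x) \<longlonglongrightarrow> phi.limit x" for x
    using * by (rule tendsto_uniform_limitI) simp
  ultimately show "\<phi> = phi.limit"
    using LIMSEQ_unique by blast
qed

lemma bdata_dilate: "bdata (n + j) (2 ^ j * p, 2 ^ j * q) = bdata n (p, q)"
  by (induction j) (simp_all add: bdata_even mult.assoc)

text \<open>The scheme keeps old values, so from level \<open>n\<close> on the sequence at a vertex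
  of that level is constant.\<close>

lemma phi_dyadic:
  assumes "2 ^ n * x $ 1 = of_int p" "2 ^ n * x $ 2 = of_int q"
  shows "phi.limit x = bdata n (p, q)"
proof (rule LIMSEQ_unique)
  show "(\<lambda>j. bdata (j + n) (cell (j + n) x)) \<longlonglongrightarrow> phi.limit x"
    using phi.tendsto_limit by (rule LIMSEQ_ignore_initial_segment)
  have "cell (j + n) x = (2 ^ j * p, 2 ^ j * q)" for j
  proof -
    have "2 ^ (j + n) * x $ 1 = of_int (2 ^ j * p)" "2 ^ (j + n) * x $ 2 = of_int (2 ^ j * q)"
      using assms by (simp_all add: power_add mult.assoc)
    then show ?thesis unfolding cell_def by (metis floor_of_int)
  qed
  then show "(\<lambda>j. bdata (j + n) (cell (j + n) x)) \<longlonglongrightarrow> bdata n (p, q)"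
    using bdata_dilate[of n] by (simp add: add.commute)
qed

section \<open>The derivative of the refinable function\<close>

text \<open>A discrete mean value estimate: unit increments close to \<open>a\<close> are summed
  along the path between \<open>p\<close> and \<open>q\<close>, in either direction.\<close>

lemma int_path_increment:
  fixes h :: "int \<Rightarrow> real"
  assumes "\<And>l. min p q \<le> l \<Longrightarrow> l < max p q \<Longrightarrow> \<bar>h (l + 1) - h l - a\<bar> \<le> \<eta>"
  shows "\<bar>h q - h p - of_int (q - p) * a\<bar> \<le> \<bar>of_int (q - p)\<bar> * \<eta>"
proof -
  have up: "\<bar>h q - h p - of_int (q - p) * a\<bar> \<le> of_int (q - p) * \<eta>"
    if "p \<le> q" "\<And>l. p \<le> l \<Longrightarrow> l < q \<Longrightarrow> \<bar>h (l + 1) - h l - a\<bar> \<le> \<eta>" for p q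
    using that
  proof (induction q rule: int_ge_induct)
    case (step i)
    have "\<bar>h i - h p - of_int (i - p) * a\<bar> \<le> of_int (i - p) * \<eta>"
      using step by simp
    moreover have "\<bar>h (i + 1) - h i - a\<bar> \<le> \<eta>"
      using step by simp
    ultimately show ?case by (simp add: algebra_simps)
  qed simp
  show ?thesis
  proof (cases "p \<le> q")
    case True
    then show ?thesis using up[OF True] assms by simp
  next
    case False
    then have "\<bar>h p - h q - of_int (p - q) * a\<bar> \<le> of_int (p - q) * \<eta>"
      using up[of q p] assms by simp
    then show ?thesis using False by (simp add: algebra_simps abs_if split: if_splits)
  qed
qed

text \<open>One error for the limit at the grid point itself and four for moving from there to
  \<open>x\<close>.\<close>

lemma (in grid_sequence) grid_value_approx:
  assumes "n \<le> N" "\<bar>of_int p / 2 ^ N - x $ 1\<bar> \<le> 1 / 2 ^ n" "\<bar>of_int q / 2 ^ N - x $ 2\<bar> \<le> 1 / 2 ^ n"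
  shows "\<bar>F N (p, q) - limit x\<bar> \<le> 5 * c * rate_tail n"
proof -
  define z :: "real^2" where "z = vector [of_int p / 2 ^ N, of_int q / 2 ^ N]"
  have z: "z $ 1 = of_int p / 2 ^ N" "z $ 2 = of_int q / 2 ^ N" by (simp_all add: z_def)
  then have "cell N z = (p, q)" by (simp add: cell_def)
  then have "\<bar>limit z - F N (p, q)\<bar> \<le> c * rate_tail N"
    using limit_approx[of z N] by simp
  also have "\<dots> \<le> c * rate_tail n"
    by (intro mult_left_mono rate_tail_antimono assms c_nonneg)
  finally have "\<bar>limit z - F N (p, q)\<bar> \<le> c * rate_tail n" .
  moreover have "\<bar>limit z - limit x\<bar> \<le> 4 * c * rate_tail n"
    using assms z by (intro limit_modulus) simp_all
  ultimately show ?thesis by (simp add: algebra_simps)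
qed

lemma floor_scaled_approx: "\<bar>of_int \<lfloor>2 ^ N * t\<rfloor> / 2 ^ N - t\<bar> \<le> 1 / (2 ^ N :: real)"
proof -
  have "of_int \<lfloor>2 ^ N * t\<rfloor> / 2 ^ N - t = (of_int \<lfloor>2 ^ N * t\<rfloor> - 2 ^ N * t) / 2 ^ N"
    by (simp add: diff_divide_distrib)
  moreover have "\<bar>of_int \<lfloor>2 ^ N * t\<rfloor> - 2 ^ N * t\<bar> \<le> 1" by linarith
  ultimately show ?thesis by (simp add: divide_right_mono)
qed

lemma floor_scaled_tendsto: "(\<lambda>N. of_int \<lfloor>2 ^ N * t\<rfloor> / 2 ^ N) \<longlonglongrightarrow> (t :: real)"
proof (rule LIM_zero_cancel, rule Lim_null_comparison)
  show "\<forall>\<^sub>F N in sequentially. norm (of_int \<lfloor>2 ^ N * t\<rfloor> / 2 ^ N - t) \<le> 1 / 2 ^ N"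
    using floor_scaled_approx by simp
  show "(\<lambda>N. 1 / 2 ^ N :: real) \<longlonglongrightarrow> 0" by real_asymp
qed

text \<open>Half of the allowed distance is the gap between \<open>s\<close> and \<open>t\<close>,
  the other half covers the rounding at level \<open>N\<close>.\<close>

lemma floor_scaled_between:
  fixes s t :: real
  assumes "min \<lfloor>2 ^ N * s\<rfloor> \<lfloor>2 ^ N * t\<rfloor> \<le> l" "l \<le> max \<lfloor>2 ^ N * s\<rfloor> \<lfloor>2 ^ N * t\<rfloor>"
    and "\<bar>t - s\<bar> \<le> 1 / 2 ^ Suc n" "Suc n \<le> N"
  shows "\<bar>of_int l / 2 ^ N - s\<bar> \<le> 1 / 2 ^ n"
proof -
  have fl: "\<bar>of_int \<lfloor>2 ^ N * r\<rfloor> / 2 ^ N - r\<bar> \<le> 1 / 2 ^ Suc n" for r :: real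
  proof -
    have "\<bar>of_int \<lfloor>2 ^ N * r\<rfloor> / 2 ^ N - r\<bar> \<le> 1 / 2 ^ N"
      by (rule floor_scaled_approx)
    also have "\<dots> \<le> 1 / 2 ^ Suc n"
      using assms(4) by (intro divide_left_mono power_increasing) auto
    finally show ?thesis .
  qed
  define A B where "A = of_int \<lfloor>2 ^ N * s\<rfloor> / (2 ^ N :: real)" and "B = of_int \<lfloor>2 ^ N * t\<rfloor> / (2 ^ N :: real)"
  have "(\<lfloor>2 ^ N * s\<rfloor> \<le> l \<and> l \<le> \<lfloor>2 ^ N * t\<rfloor>) \<or> (\<lfloor>2 ^ N * t\<rfloor> \<le> l \<and> l \<le> \<lfloor>2 ^ N * s\<rfloor>)"
    using assms(1,2) by linarith
  then have "(A \<le> of_int l / 2 ^ N \<and> of_int l / 2 ^ N \<le> B) \<or> (B \<le> of_int l / 2 ^ N \<and> of_int l / 2 ^ N \<le> A)"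
    unfolding A_def B_def by (auto simp: divide_right_mono)
  moreover have "\<bar>A - s\<bar> \<le> 1 / 2 ^ Suc n" "\<bar>B - t\<bar> \<le> 1 / 2 ^ Suc n"
    unfolding A_def B_def by (rule fl)+
  moreover have "1 / 2 ^ n = 1 / 2 ^ Suc n + (1 / 2 ^ Suc n :: real)" by simp
  ultimately show ?thesis using assms(3) by linarith
qed

text \<open>On a fine grid of level \<open>N\<close> one walks from the cell of \<open>x\<close> to
  that of \<open>y\<close>, first horizontally, then vertically. All difference quotients met are
  within \<open>80 * rate_tail n\<close> of the limits at \<open>x\<close>, where 80 = 5 * 16; then
  \<open>N\<close> tends to infinity.\<close>

lemma phi_increment:
  assumes "\<bar>y $ 1 - x $ 1\<bar> \<le> 1 / 2 ^ Suc n" "\<bar>y $ 2 - x $ 2\<bar> \<le> 1 / 2 ^ Suc n"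
  shows "\<bar>phi.limit y - phi.limit x - g1.limit x * (y $ 1 - x $ 1) - g2.limit x * (y $ 2 - x $ 2)\<bar>
    \<le> 80 * rate_tail n * (\<bar>y $ 1 - x $ 1\<bar> + \<bar>y $ 2 - x $ 2\<bar>)"
proof -
  define X Y where "X N i = \<lfloor>2 ^ N * x $ i\<rfloor>" and "Y N i = \<lfloor>2 ^ N * y $ i\<rfloor>" for N :: nat and i :: 2
  define D where "D N i = of_int (Y N i) / 2 ^ N - of_int (X N i) / (2 ^ N :: real)" for N i
  let ?\<eta> = "80 * rate_tail n"
  have cells: "cell N x = (X N 1, X N 2)" "cell N y = (Y N 1, Y N 2)" for N
    by (simp_all add: cell_def X_def Y_def)
  have D: "(\<lambda>N. D N i) \<longlonglongrightarrow> y $ i - x $ i" for i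
    unfolding D_def X_def Y_def by (intro tendsto_diff floor_scaled_tendsto)
  have step: "\<bar>bdata N (cell N y) - bdata N (cell N x) - g1.limit x * D N 1 - g2.limit x * D N 2\<bar>
      \<le> ?\<eta> * (\<bar>D N 1\<bar> + \<bar>D N 2\<bar>)" if N: "Suc n \<le> N" for N
  proof -
    have nN: "n \<le> N" using N by simp
    have scale: "of_int (Y N i - X N i) = 2 ^ N * D N i" for i
      by (simp add: D_def field_simps)
    have near2: "\<bar>of_int (X N 2) / 2 ^ N - x $ 2\<bar> \<le> 1 / 2 ^ n"
      using floor_scaled_between[OF _ _ assms(2) N, of "X N 2"] by (simp add: X_def)
    have near1: "\<bar>of_int (Y N 1) / 2 ^ N - x $ 1\<bar> \<le> 1 / 2 ^ n"
      using floor_scaled_between[OF _ _ assms(1) N, of "Y N 1"] by (simp add: Y_def)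
    have "\<bar>2 ^ N * bdata N (Y N 1, X N 2) - 2 ^ N * bdata N (X N 1, X N 2)
        - of_int (Y N 1 - X N 1) * g1.limit x\<bar> \<le> \<bar>of_int (Y N 1 - X N 1)\<bar> * ?\<eta>"
    proof (rule int_path_increment[where h = "\<lambda>p. 2 ^ N * bdata N (p, X N 2)"])
      fix l assume l: "min (X N 1) (Y N 1) \<le> l" "l < max (X N 1) (Y N 1)"
      have "\<bar>diff1 N (l, X N 2) - g1.limit x\<bar> \<le> 5 * 16 * rate_tail n"
        by (rule g1.grid_value_approx[OF nN _ near2], rule floor_scaled_between[OF _ _ assms(1) N])
          (use l in \<open>simp_all add: X_def Y_def\<close>)
      then show "\<bar>2 ^ N * bdata N (l + 1, X N 2) - 2 ^ N * bdata N (l, X N 2) - g1.limit x\<bar> \<le> ?\<eta>"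
        by (simp add: diff1_def algebra_simps)
    qed
    moreover have "\<bar>2 ^ N * bdata N (Y N 1, Y N 2) - 2 ^ N * bdata N (Y N 1, X N 2)
        - of_int (Y N 2 - X N 2) * g2.limit x\<bar> \<le> \<bar>of_int (Y N 2 - X N 2)\<bar> * ?\<eta>"
    proof (rule int_path_increment[where h = "\<lambda>q. 2 ^ N * bdata N (Y N 1, q)"])
      fix l assume l: "min (X N 2) (Y N 2) \<le> l" "l < max (X N 2) (Y N 2)"
      have "\<bar>diff2 N (Y N 1, l) - g2.limit x\<bar> \<le> 5 * 16 * rate_tail n"
        by (rule g2.grid_value_approx[OF nN near1], rule floor_scaled_between[OF _ _ assms(2) N])
          (use l in \<open>simp_all add: X_def Y_def\<close>)
      then show "\<bar>2 ^ N * bdata N (Y N 1, l + 1) - 2 ^ N * bdata N (Y N 1, l) - g2.limit x\<bar> \<le> ?\<eta>"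
        by (simp add: diff2_def algebra_simps)
    qed
    ultimately have "\<bar>(2 ^ N * bdata N (Y N 1, X N 2) - 2 ^ N * bdata N (X N 1, X N 2)
          - 2 ^ N * D N 1 * g1.limit x)
        + (2 ^ N * bdata N (Y N 1, Y N 2) - 2 ^ N * bdata N (Y N 1, X N 2) - 2 ^ N * D N 2 * g2.limit x)\<bar>
      \<le> \<bar>2 ^ N * D N 1\<bar> * ?\<eta> + \<bar>2 ^ N * D N 2\<bar> * ?\<eta>" (is "\<bar>?S\<bar> \<le> _")
      unfolding scale by (rule order.trans[OF abs_triangle_ineq add_mono])
    moreover have "?S = 2 ^ N * (bdata N (Y N 1, Y N 2) - bdata N (X N 1, X N 2)
        - g1.limit x * D N 1 - g2.limit x * D N 2)"
      by (simp add: algebra_simps)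
    ultimately have "\<bar>2 ^ N * (bdata N (Y N 1, Y N 2) - bdata N (X N 1, X N 2)
        - g1.limit x * D N 1 - g2.limit x * D N 2)\<bar> \<le> \<bar>2 ^ N * D N 1\<bar> * ?\<eta> + \<bar>2 ^ N * D N 2\<bar> * ?\<eta>"
      by (simp only:)
    also have "\<dots> = 2 ^ N * (?\<eta> * (\<bar>D N 1\<bar> + \<bar>D N 2\<bar>))"
      by (simp add: abs_mult algebra_simps)
    finally have "2 ^ N * \<bar>bdata N (Y N 1, Y N 2) - bdata N (X N 1, X N 2) - g1.limit x * D N 1 - g2.limit x * D N 2\<bar>
      \<le> 2 ^ N * (?\<eta> * (\<bar>D N 1\<bar> + \<bar>D N 2\<bar>))"
      unfolding abs_mult by simp
    then show ?thesis unfolding cells by simp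
  qed
  show ?thesis
  proof (rule LIMSEQ_le)
    show "(\<lambda>N. \<bar>bdata N (cell N y) - bdata N (cell N x) - g1.limit x * D N 1 - g2.limit x * D N 2\<bar>)
      \<longlonglongrightarrow> \<bar>phi.limit y - phi.limit x - g1.limit x * (y $ 1 - x $ 1) - g2.limit x * (y $ 2 - x $ 2)\<bar>"
      by (intro tendsto_intros phi.tendsto_limit D)
    show "(\<lambda>N. ?\<eta> * (\<bar>D N 1\<bar> + \<bar>D N 2\<bar>)) \<longlonglongrightarrow> ?\<eta> * (\<bar>y $ 1 - x $ 1\<bar> + \<bar>y $ 2 - x $ 2\<bar>)"
      by (intro tendsto_intros D)
    show "\<exists>N. \<forall>m\<ge>N. \<bar>bdata m (cell m y) - bdata m (cell m x) - g1.limit x * D m 1 - g2.limit x * D m 2\<bar>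
      \<le> ?\<eta> * (\<bar>D m 1\<bar> + \<bar>D m 2\<bar>)"
      using step by blast
  qed
qed

lemma phi_has_derivative:
  "(phi.limit has_derivative (\<lambda>v. g1.limit x * v $ 1 + g2.limit x * v $ 2)) (at x)"
  unfolding has_derivative_at_alt
proof (intro conjI allI impI)
  show "bounded_linear (\<lambda>v. g1.limit x * v $ 1 + g2.limit x * v $ 2)"
    by (intro bounded_linear_add bounded_linear_const_mult bounded_linear_vec_nth)
  fix e :: real assume "e > 0"
  \<comment> \<open>The two coordinates of \<open>y - x\<close> add up to at most twice its norm,
    whence 160 = 2 * 80.\<close>
  have "(\<lambda>n. 160 * rate_tail n) \<longlonglongrightarrow> 0"
    using tendsto_mult[OF tendsto_const rate_tail_tendsto, of 160] by simp
  then obtain n where n: "160 * rate_tail n < e"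
    using order_tendstoD(2)[OF _ \<open>e > 0\<close>] eventually_happens'[OF sequentially_bot] by blast
  have "norm (phi.limit y - phi.limit x - (g1.limit x * (y - x) $ 1 + g2.limit x * (y - x) $ 2)) \<le> e * norm (y - x)"
    if y: "norm (y - x) < 1 / 2 ^ Suc n" for y
  proof -
    have c: "\<bar>y $ 1 - x $ 1\<bar> \<le> norm (y - x)" "\<bar>y $ 2 - x $ 2\<bar> \<le> norm (y - x)"
      using component_le_norm_cart[of "y - x"] by simp_all
    have "norm (phi.limit y - phi.limit x - (g1.limit x * (y - x) $ 1 + g2.limit x * (y - x) $ 2))
      \<le> 80 * rate_tail n * (\<bar>y $ 1 - x $ 1\<bar> + \<bar>y $ 2 - x $ 2\<bar>)"
      using phi_increment[of y x n] c y by (simp add: diff_diff_eq)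
    also have "\<dots> \<le> 80 * rate_tail n * (2 * norm (y - x))"
      using c rate_tail_pos[of n] by (intro mult_left_mono) auto
    also have "\<dots> \<le> e * norm (y - x)"
      using n mult_right_mono[of "160 * rate_tail n" e "norm (y - x)"] by simp
    finally show ?thesis .
  qed
  then show "\<exists>d>0. \<forall>y. norm (y - x) < d \<longrightarrow>
      norm (phi.limit y - phi.limit x - (g1.limit x * (y - x) $ 1 + g2.limit x * (y - x) $ 2)) \<le> e * norm (y - x)"
    by (intro exI[of _ "1 / 2 ^ Suc n"]) simp
qed

lemma frechet_derivative_phi:
  "frechet_derivative phi.limit (at x) v = g1.limit x * v $ 1 + g2.limit x * v $ 2"
  using frechet_derivative_at[OF phi_has_derivative, of x] by metis

section \<open>The modulus of continuity of the derivative\<close>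

lemma iterated_derivative_phi:
  "iterated_derivative phi.limit [v] x = g1.limit x * v $ 1 + g2.limit x * v $ 2"
  by (simp add: frechet_derivative_phi)

lemma derivative_dist_phi_le:
  "derivative_dist 1 phi.limit x y \<le> ennreal (\<bar>g1.limit x - g1.limit y\<bar> + \<bar>g2.limit x - g2.limit y\<bar>)"
  unfolding derivative_dist_def
proof (rule SUP_least, clarify)
  fix vs :: "(real^2) list" assume vs: "length vs = 1" "\<forall>v\<in>set vs. norm v \<le> 1"
  then obtain v where v: "vs = [v]" by (auto simp: length_Suc_conv)
  have c: "\<bar>v $ i\<bar> \<le> 1" for i
    using component_le_norm_cart[of v i] vs v by simp
  have "norm (iterated_derivative phi.limit vs x - iterated_derivative phi.limit vs y) =
      \<bar>(g1.limit x - g1.limit y) * v $ 1 + (g2.limit x - g2.limit y) * v $ 2\<bar>"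
    unfolding v iterated_derivative_phi by (simp add: algebra_simps)
  also have "\<dots> \<le> \<bar>g1.limit x - g1.limit y\<bar> * \<bar>v $ 1\<bar> + \<bar>g2.limit x - g2.limit y\<bar> * \<bar>v $ 2\<bar>"
    unfolding abs_mult[symmetric] by (rule abs_triangle_ineq)
  also have "\<dots> \<le> \<bar>g1.limit x - g1.limit y\<bar> * 1 + \<bar>g2.limit x - g2.limit y\<bar> * 1"
    by (intro add_mono mult_left_mono c) auto
  finally show "ennreal (norm (iterated_derivative phi.limit vs x - iterated_derivative phi.limit vs y))
      \<le> ennreal (\<bar>g1.limit x - g1.limit y\<bar> + \<bar>g2.limit x - g2.limit y\<bar>)"
    by (intro ennreal_leI) simp
qed

lemma axis_1_components: "(axis 1 1 :: real^2) $ 1 = 1" "(axis 1 1 :: real^2) $ 2 = 0"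
  by (simp_all add: axis_def)

lemma derivative_dist_phi_ge: "ennreal \<bar>g1.limit x - g1.limit y\<bar> \<le> derivative_dist 1 phi.limit x y"
  unfolding derivative_dist_def
  by (rule SUP_upper2[of "[axis 1 1]"]) (simp_all add: frechet_derivative_phi axis_1_components norm_axis_1)

lemma modulus_phi_leI:
  assumes "\<And>x \<xi>. norm \<xi> \<le> h \<Longrightarrow> \<bar>g1.limit (x + \<xi>) - g1.limit x\<bar> \<le> B"
    and "\<And>x \<xi>. norm \<xi> \<le> h \<Longrightarrow> \<bar>g2.limit (x + \<xi>) - g2.limit x\<bar> \<le> B"
  shows "derivative_modulus 1 phi.limit h \<le> ennreal (2 * B)"
  unfolding derivative_modulus_def
proof (rule SUP_least, clarify)
  fix x \<xi> :: "real^2" assume \<xi>: "norm \<xi> \<le> h"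
  have "derivative_dist 1 phi.limit (x + \<xi>) x
      \<le> ennreal (\<bar>g1.limit (x + \<xi>) - g1.limit x\<bar> + \<bar>g2.limit (x + \<xi>) - g2.limit x\<bar>)"
    by (rule derivative_dist_phi_le)
  also have "\<dots> \<le> ennreal (2 * B)"
    using assms[OF \<xi>, of x] by (intro ennreal_leI) simp
  finally show "derivative_dist 1 phi.limit (x + \<xi>) x \<le> ennreal (2 * B)" .
qed

lemma modulus_phi_le_rate_tail:
  assumes "h \<le> 1 / 2 ^ n"
  shows "derivative_modulus 1 phi.limit h \<le> ennreal (128 * rate_tail n)"
proof -
  have "\<bar>\<xi> $ i\<bar> \<le> 1 / 2 ^ n" if "norm \<xi> \<le> h" for \<xi> :: "real^2" and i
    using component_le_norm_cart[of \<xi> i] that assms by linarith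
  then have "derivative_modulus 1 phi.limit h \<le> ennreal (2 * (4 * 16 * rate_tail n))"
    by (intro modulus_phi_leI g1.limit_modulus g2.limit_modulus) auto
  then show ?thesis by simp
qed

text \<open>Each partial derivative is at most 1 + 12 * 16 = 193 in absolute value, so it varies by
  at most 386. This covers large \<open>h\<close> in the Hoelder estimate.\<close>

lemma modulus_phi_bounded: "derivative_modulus 1 phi.limit h \<le> ennreal 772"
proof -
  have "derivative_modulus 1 phi.limit h \<le> ennreal (2 * 386)"
  proof (rule modulus_phi_leI)
    fix x \<xi> :: "real^2"
    show "\<bar>g1.limit (x + \<xi>) - g1.limit x\<bar> \<le> 386"
      using g1.bounded_limit[OF diff_0_bounded(1), of x] g1.bounded_limit[OF diff_0_bounded(1), of "x + \<xi>"]
      by linarith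
    show "\<bar>g2.limit (x + \<xi>) - g2.limit x\<bar> \<le> 386"
      using g2.bounded_limit[OF diff_0_bounded(2), of x] g2.bounded_limit[OF diff_0_bounded(2), of "x + \<xi>"]
      by linarith
  qed
  then show ?thesis by simp
qed

text \<open>
  The second difference of \<open>\<phi>\<close> at the origin with step \<open>2\<^sup>-\<^sup>n\<close> is known exactly; by the mean value
  theorem it is a difference of values of the partial derivative.
\<close>

lemma partial_derivative_spread:
  obtains y z where "norm y \<le> 1 / 2 ^ n" "norm z \<le> 1 / 2 ^ n"
    "(real n)\<^sup>2 / 4 / 2 ^ n \<le> \<bar>g1.limit y - g1.limit z\<bar>"
proof -
  define e :: "real^2" where "e = axis 1 1"
  let ?\<delta> = "1 / 2 ^ n :: real"
  let ?D = "(1 + 7 / 8 * real n + (real n)\<^sup>2 / 8) / 4 ^ n"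
  have e: "e $ 1 = 1" "e $ 2 = 0" by (simp_all add: e_def axis_1_components)
  have deriv: "((\<lambda>t. phi.limit (t *\<^sub>R e)) has_real_derivative g1.limit (t *\<^sub>R e)) (at t)" for t
  proof -
    have "((\<lambda>t. t *\<^sub>R e) has_derivative (\<lambda>t. t *\<^sub>R e)) (at t)"
      by (auto intro!: derivative_eq_intros)
    from has_derivative_compose[OF this phi_has_derivative]
    show ?thesis unfolding has_field_derivative_def by (simp add: e mult.commute[of _ "g1.limit _"])
  qed
  have "bdata n (-1, 0) = bdata n (1, 0)"
    using bdata_rot[of n "(1, 0)"] bdata_rot[of n "(1, 1)"] bdata_rot[of n "(0, 1)"]
    by (simp add: rot_def)
  then have vals: "phi.limit (?\<delta> *\<^sub>R e) = 1 - ?D" "phi.limit (0 *\<^sub>R e) = 1"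
    "phi.limit ((- ?\<delta>) *\<^sub>R e) = 1 - ?D"
    using phi_dyadic[of n "?\<delta> *\<^sub>R e" 1 0] phi_dyadic[of n "0 *\<^sub>R e" 0 0] phi_dyadic[of n "(- ?\<delta>) *\<^sub>R e" "-1" 0]
    by (simp_all add: e bdata_at_origin)
  \<comment> \<open>\<phi> takes the same value on both sides of the origin, so the mean slopes on
    the two intervals are opposite and their difference is twice \<open>?D\<close> divided by the
    step length.\<close>
  obtain s where s: "0 < s" "s < ?\<delta>" "phi.limit (?\<delta> *\<^sub>R e) - phi.limit (0 *\<^sub>R e) = (?\<delta> - 0) * g1.limit (s *\<^sub>R e)"
    using MVT2[of 0 ?\<delta> "\<lambda>t. phi.limit (t *\<^sub>R e)" "\<lambda>t. g1.limit (t *\<^sub>R e)"] deriv by auto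
  obtain t where t: "- ?\<delta> < t" "t < 0"
    "phi.limit (0 *\<^sub>R e) - phi.limit ((- ?\<delta>) *\<^sub>R e) = (0 - (- ?\<delta>)) * g1.limit (t *\<^sub>R e)"
    using MVT2[of "- ?\<delta>" 0 "\<lambda>t. phi.limit (t *\<^sub>R e)" "\<lambda>t. g1.limit (t *\<^sub>R e)"] deriv by auto
  have "?\<delta> * (g1.limit (t *\<^sub>R e) - g1.limit (s *\<^sub>R e)) = 2 * ?D"
    using s(3) t(3) unfolding vals by (simp add: algebra_simps)
  then have "g1.limit (t *\<^sub>R e) - g1.limit (s *\<^sub>R e) = 2 * ?D * 2 ^ n"
    by (simp add: field_simps)
  also have "\<dots> = 2 * (1 + 7 / 8 * real n + (real n)\<^sup>2 / 8) / 2 ^ n"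
    by (simp add: field_simps flip: power_mult_distrib)
  finally have "g1.limit (t *\<^sub>R e) - g1.limit (s *\<^sub>R e)
      = 2 * (1 + 7 / 8 * real n + (real n)\<^sup>2 / 8) / 2 ^ n" .
  moreover have "(real n)\<^sup>2 / 4 / 2 ^ n \<le> 2 * (1 + 7 / 8 * real n + (real n)\<^sup>2 / 8) / 2 ^ n"
    by (intro divide_right_mono) auto
  ultimately have "(real n)\<^sup>2 / 4 / 2 ^ n \<le> g1.limit (t *\<^sub>R e) - g1.limit (s *\<^sub>R e)"
    by linarith
  then have "(real n)\<^sup>2 / 4 / 2 ^ n \<le> \<bar>g1.limit (t *\<^sub>R e) - g1.limit (s *\<^sub>R e)\<bar>"
    by linarith
  moreover have "norm (t *\<^sub>R e) \<le> ?\<delta>" "norm (s *\<^sub>R e) \<le> ?\<delta>"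
    using s t by (simp_all add: e_def norm_axis_1)
  ultimately show ?thesis using that by blast
qed

lemma modulus_phi_ge:
  assumes "2 / 2 ^ n \<le> h"
  shows "ennreal ((real n)\<^sup>2 / 4 / 2 ^ n) \<le> derivative_modulus 1 phi.limit h"
proof -
  obtain y z where yz: "norm y \<le> 1 / 2 ^ n" "norm z \<le> 1 / 2 ^ n"
    "(real n)\<^sup>2 / 4 / 2 ^ n \<le> \<bar>g1.limit y - g1.limit z\<bar>"
    by (rule partial_derivative_spread)
  have "ennreal ((real n)\<^sup>2 / 4 / 2 ^ n) \<le> ennreal \<bar>g1.limit y - g1.limit z\<bar>"
    using yz by (intro ennreal_leI)
  also have "\<dots> \<le> derivative_dist 1 phi.limit (z + (y - z)) z"
    using derivative_dist_phi_ge by simp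
  also have "\<dots> \<le> derivative_modulus 1 phi.limit h"
    unfolding derivative_modulus_def
    using norm_triangle_ineq4[of y z] yz assms by (intro SUP_upper2[of "(z, y - z)"]) auto
  finally show ?thesis .
qed

lemma dyadic_bracket:
  assumes "0 < h" "h \<le> (1 :: real)"
  obtains n where "1 / 2 ^ Suc n < h" "h \<le> 1 / 2 ^ n"
proof -
  obtain N where "(1 / 2) ^ N < h" using real_arch_pow_inv[of h "1 / 2"] assms by auto
  then have "1 / 2 ^ N < h" by (simp add: power_one_over)
  then obtain k where "\<forall>i\<le>k. \<not> 1 / 2 ^ i < h" "1 / 2 ^ Suc k < h"
    using ex_least_nat_less[of "\<lambda>n. 1 / 2 ^ n < h" N] assms by auto
  then show ?thesis using that[of k] by (meson linorder_not_less order_refl)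
qed

lemma modulus_phi_asymp:
  assumes h: "0 < h" "h < 1 / 2"
  shows "ennreal (1 / (16 * (ln 2)\<^sup>2) * (h * \<bar>ln h\<bar>\<^sup>2)) \<le> derivative_modulus 1 phi.limit h"
    and "derivative_modulus 1 phi.limit h \<le> ennreal (12288 / (ln 2)\<^sup>2 * (h * \<bar>ln h\<bar>\<^sup>2))"
proof -
  obtain n where n: "1 / 2 ^ Suc n < h" "h \<le> 1 / 2 ^ n"
    using dyadic_bracket[of h] h by auto
  \<comment> \<open>The absolute value of the binary logarithm of \<open>h\<close>; the dyadic
    bracket places it between \<open>n\<close> and \<open>n + 1\<close>.\<close>
  define l where "l = \<bar>ln h\<bar> / ln 2"
  have l0: "l \<ge> 0" by (simp add: l_def)
  have hl: "h * \<bar>ln h\<bar>\<^sup>2 = (ln 2)\<^sup>2 * (h * l\<^sup>2)"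
    by (simp add: l_def power_divide)
  have abs: "\<bar>ln h\<bar> = - ln h" using h by simp
  have "ln (1 / 2 ^ Suc n) \<le> ln h" "ln h \<le> ln (1 / 2 ^ n)"
    using n h by (simp_all add: ln_le_cancel_iff del: power_Suc)
  then have "real n * ln 2 \<le> \<bar>ln h\<bar>" "\<bar>ln h\<bar> \<le> real (Suc n) * ln 2"
    unfolding abs by (simp_all add: ln_div ln_realpow del: power_Suc of_nat_Suc)
  then have ln: "real n \<le> l" "l \<le> real n + 1"
    by (simp_all add: l_def field_simps)
  \<comment> \<open>Here \<open>h < 1 / 2\<close> enters: it keeps the logarithm away from 0 and
    yields \<open>n + 1 \<le> 2 * l\<close> for the upper bound.\<close>
  have "n \<noteq> 0" using n h by (intro notI) simp
  then have n1: "real n \<ge> 1" by simp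
  have "ennreal (1 / (16 * (ln 2)\<^sup>2) * (h * \<bar>ln h\<bar>\<^sup>2)) = ennreal (h / 4 * (l\<^sup>2 / 4))"
    unfolding hl by simp
  \<comment> \<open>Level \<open>n + 2\<close> is chosen because
    \<open>2 / 2 ^ (n + 2) = 1 / 2 ^ Suc n\<close> lies below \<open>h\<close>.\<close>
  also have "\<dots> \<le> ennreal (1 / 2 ^ (n + 2) * ((real (n + 2))\<^sup>2 / 4))"
    using n(2) ln l0 h by (intro ennreal_leI mult_mono divide_right_mono power_mono) auto
  also have "\<dots> \<le> derivative_modulus 1 phi.limit h"
    using modulus_phi_ge[of "n + 2" h] n(1) by (simp add: field_simps)
  finally show "ennreal (1 / (16 * (ln 2)\<^sup>2) * (h * \<bar>ln h\<bar>\<^sup>2)) \<le> derivative_modulus 1 phi.limit h" .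
  have "derivative_modulus 1 phi.limit h \<le> ennreal (128 * rate_tail n)"
    by (rule modulus_phi_le_rate_tail[OF n(2)])
  also have "\<dots> \<le> ennreal (1536 * ((real n + 1)\<^sup>2 * (1 / 2 ^ n)))"
    using rate_tail_le_rate[of n] by (intro ennreal_leI) (simp add: rate_def)
  also have "\<dots> \<le> ennreal (1536 * ((2 * l)\<^sup>2 * (2 * h)))"
    using n(1) ln n1 by (intro ennreal_leI mult_left_mono mult_mono power_mono) (auto simp: field_simps)
  also have "\<dots> = ennreal (12288 / (ln 2)\<^sup>2 * (h * \<bar>ln h\<bar>\<^sup>2))"
    unfolding hl by (simp add: power_mult_distrib mult_ac)
  finally show "derivative_modulus 1 phi.limit h \<le> ennreal (12288 / (ln 2)\<^sup>2 * (h * \<bar>ln h\<bar>\<^sup>2))" .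
qed

section \<open>Order of smoothness and Hoelder exponent\<close>

lemma Cn_SucD: "Cn (Suc n) f \<Longrightarrow> Cn n f"
proof (induction n arbitrary: f)
  case 0
  then show ?case
    by (auto intro!: continuous_at_imp_continuous_on differentiable_imp_continuous_within)
next
  case (Suc n)
  then show ?case by (metis Cn.simps(2))
qed

lemma Cn_le: "m \<le> n \<Longrightarrow> Cn n f \<Longrightarrow> Cn m f"
  by (induction rule: inc_induct) (auto intro: Cn_SucD simp del: Cn.simps)

lemma Cn_1_phi: "Cn 1 phi.limit"
  unfolding One_nat_def Cn.simps frechet_derivative_phi
  using phi_has_derivative
  by (auto simp: differentiable_def intro!: continuous_intros g1.continuous_limit g2.continuous_limit)

text \<open>Differentiability of the first partial derivative at the origin would bound its
  variation there by a multiple of the distance, whereas at distance \<open>1 / 2 ^ n\<close> it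
  varies by at least \<open>n\<^sup>2 / 4\<close> times that distance.\<close>

lemma not_Cn_2_phi: "\<not> Cn 2 phi.limit"
proof
  assume "Cn 2 phi.limit"
  then have "Cn (Suc 0) (\<lambda>x. frechet_derivative phi.limit (at x) (axis 1 1))"
    unfolding numeral_2_eq_2 Cn.simps(2)[of "Suc 0"] by blast
  then have "g1.limit differentiable (at 0)"
    by (simp add: frechet_derivative_phi axis_1_components)
  then obtain g' where g': "(g1.limit has_derivative g') (at 0)"
    unfolding differentiable_def by blast
  then have "bounded_linear g'" by (rule has_derivative_bounded_linear)
  then obtain K where K: "\<And>z. norm (g' z) \<le> norm z * K"
    using bounded_linear.bounded by blast
  have "\<exists>d>0. \<forall>z. norm (z - 0) < d \<longrightarrow> norm (g1.limit z - g1.limit 0 - g' (z - 0)) \<le> 1 * norm (z - 0)"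
    using g' zero_less_one unfolding has_derivative_at_alt by blast
  then obtain d where d: "d > 0"
    "\<And>z. norm z < d \<Longrightarrow> norm (g1.limit z - g1.limit 0 - g' z) \<le> norm z"
    by auto
  have near: "\<bar>g1.limit z - g1.limit 0\<bar> \<le> (K + 1) * norm z" if "norm z < d" for z
    using d(2)[OF that] K[of z] by (simp add: algebra_simps)
  have K0: "K + 1 \<ge> 0" using order.trans[OF norm_ge_zero K[of "axis 1 1"]] by (simp add: norm_axis_1)
  have "(\<lambda>n. 1 / 2 ^ n :: real) \<longlonglongrightarrow> 0" by real_asymp
  then have "\<forall>\<^sub>F n in sequentially. 1 / 2 ^ n < d"
    using d(1) by (rule order_tendstoD)
  moreover have "\<forall>\<^sub>F n in sequentially. (real n)\<^sup>2 / 4 > 2 * (K + 1)"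
    by real_asymp
  ultimately obtain n where n: "1 / 2 ^ n < d" "(real n)\<^sup>2 / 4 > 2 * (K + 1)"
    using eventually_happens'[OF sequentially_bot eventually_conj] by blast
  obtain y z where yz: "norm y \<le> 1 / 2 ^ n" "norm z \<le> 1 / 2 ^ n"
    "(real n)\<^sup>2 / 4 / 2 ^ n \<le> \<bar>g1.limit y - g1.limit z\<bar>"
    by (rule partial_derivative_spread)
  have "\<bar>g1.limit w - g1.limit 0\<bar> \<le> (K + 1) * (1 / 2 ^ n)" if "norm w \<le> 1 / 2 ^ n" for w
    using near[of w] mult_left_mono[OF that K0] that n(1) by linarith
  from this[OF yz(1)] this[OF yz(2)] yz(3)
  have "(real n)\<^sup>2 / 4 / 2 ^ n \<le> 2 * ((K + 1) * (1 / 2 ^ n))" by linarith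
  then show False using divide_strict_right_mono[OF n(2), of "2 ^ n"] by simp
qed

lemma Greatest_Cn_phi: "(GREATEST n. Cn n phi.limit) = 1"
proof (rule Greatest_equality)
  show "Cn 1 phi.limit" by (rule Cn_1_phi)
  fix n assume "Cn n phi.limit"
  then show "n \<le> 1" using Cn_le[of 2 n phi.limit] not_Cn_2_phi by (cases "n \<le> 1") auto
qed

text \<open>For \<alpha> < 1 the exponential gain absorbs the quadratic factor of
  \<open>rate_tail\<close>. In the final constant \<open>128 * K\<close> serves
  \<open>h \<le> 1\<close>, and 772 serves \<open>h > 1\<close>, where
  \<open>h powr \<alpha> \<ge> 1\<close>.\<close>

lemma holder_bound_phi:
  assumes \<alpha>: "0 \<le> \<alpha>" "\<alpha> < 1"
  shows "\<exists>C. \<forall>h>0. derivative_modulus 1 phi.limit h \<le> ennreal (C * h powr \<alpha>)"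
proof -
  have "(\<lambda>n. rate_tail n * 2 powr (\<alpha> * (real n + 1))) \<longlonglongrightarrow> 0"
    unfolding rate_tail_def using \<alpha> by real_asymp
  then have "Bseq (\<lambda>n. rate_tail n * 2 powr (\<alpha> * (real n + 1)))"
    by (rule convergent_imp_Bseq[OF convergentI])
  then obtain K where K: "K > 0" "\<And>n. norm (rate_tail n * 2 powr (\<alpha> * (real n + 1))) \<le> K"
    unfolding Bseq_def by blast
  have le: "rate_tail n \<le> K * (1 / 2 ^ Suc n) powr \<alpha>" for n
  proof -
    have "(1 / 2 ^ Suc n) powr \<alpha> = 1 / 2 powr (\<alpha> * (real n + 1))"
      by (simp add: powr_divide powr_powr ac_simps flip: powr_realpow del: power_Suc)
    moreover have "rate_tail n \<le> K / 2 powr (\<alpha> * (real n + 1))"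
      using K(2)[of n] rate_tail_pos[of n] by (simp add: pos_le_divide_eq)
    ultimately show ?thesis by (simp del: power_Suc)
  qed
  have "derivative_modulus 1 phi.limit h \<le> ennreal ((128 * K + 772) * h powr \<alpha>)" if "h > 0" for h
  proof (cases "h \<le> 1")
    case True
    obtain n where n: "1 / 2 ^ Suc n < h" "h \<le> 1 / 2 ^ n"
      using dyadic_bracket[of h] \<open>h > 0\<close> True by blast
    have "rate_tail n \<le> K * h powr \<alpha>"
      using n \<alpha> K by (intro order.trans[OF le] mult_left_mono powr_mono2) auto
    then have "128 * rate_tail n \<le> (128 * K + 772) * h powr \<alpha>"
      by (simp add: distrib_right add_increasing2)
    then show ?thesis
      using modulus_phi_le_rate_tail[OF n(2)] ennreal_leI order.trans by blast
  next
    case False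
    have "1 \<le> h powr \<alpha>" using False \<alpha> by (intro ge_one_powr_ge_zero) auto
    then have "772 * 1 \<le> (128 * K + 772) * h powr \<alpha>"
      using K by (intro mult_mono) auto
    then show ?thesis
      using modulus_phi_bounded[of h] ennreal_leI[of 772] order.trans by fastforce
  qed
  then show ?thesis by blast
qed

text \<open>For \<alpha> > 1 and \<open>h = 2 / 2 ^ n\<close> the assumed bound is at most a
  multiple of \<open>h\<close>, which the factor \<open>n\<^sup>2\<close> of the lower bound exceeds
  for large \<open>n\<close>. \<open>max C 0\<close> is used since \<open>C\<close> may be
  negative.\<close>

lemma holder_bound_phi_imp_le_1:
  assumes "\<forall>h>0. derivative_modulus 1 phi.limit h \<le> ennreal (C * h powr \<alpha>)"
  shows "\<alpha> \<le> 1"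
proof (rule ccontr)
  assume "\<not> \<alpha> \<le> 1"
  have "\<forall>\<^sub>F n in sequentially. n \<ge> 1 \<and> (real n)\<^sup>2 / 4 > max C 0 * 2"
    by (intro eventually_conj eventually_ge_at_top) real_asymp
  then obtain n where n: "n \<ge> 1" "(real n)\<^sup>2 / 4 > max C 0 * 2"
    using eventually_happens'[OF sequentially_bot] by blast
  let ?h = "2 / 2 ^ n :: real"
  have h: "0 < ?h" "?h \<le> 1"
    using n self_le_power[of 2 n] by (auto simp: field_simps)
  have "ennreal ((real n)\<^sup>2 / 4 / 2 ^ n) \<le> ennreal (C * ?h powr \<alpha>)"
    using modulus_phi_ge[of n ?h] assms h order.trans by blast
  also have "\<dots> \<le> ennreal (max C 0 * ?h)"
    using powr_mono'[of 1 \<alpha> ?h] h \<open>\<not> \<alpha> \<le> 1\<close> by (intro ennreal_leI mult_mono) auto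
  finally have "(real n)\<^sup>2 / 4 / 2 ^ n \<le> max C 0 * 2 / 2 ^ n" by (simp add: ennreal_le_iff)
  then show False using divide_strict_right_mono[OF n(2), of "2 ^ n"] by simp
qed

lemma holder_exponent_phi: "holder_exponent phi.limit = 2"
proof -
  let ?S = "{\<alpha>. 0 \<le> \<alpha> \<and> (\<exists>C. \<forall>h>0. derivative_modulus 1 phi.limit h \<le> ennreal (C * h powr \<alpha>))}"
  have "(SUP \<alpha>\<in>?S. ereal \<alpha>) = 1"
  proof (rule antisym)
    show "(SUP \<alpha>\<in>?S. ereal \<alpha>) \<le> 1"
      using holder_bound_phi_imp_le_1 by (intro SUP_least) auto
    show "1 \<le> (SUP \<alpha>\<in>?S. ereal \<alpha>)"
      unfolding le_SUP_iff
    proof (intro allI impI)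
      fix y :: ereal assume "y < 1"
      then obtain r where r: "y < ereal r" "ereal r < 1"
        using ereal_dense2 by blast
      \<comment> \<open>The real number between \<open>y\<close> and 1 may be negative, while
        exponents in \<open>?S\<close> are not.\<close>
      have "max r 0 \<in> ?S" using holder_bound_phi[of "max r 0"] r by simp
      moreover have "y < ereal (max r 0)" using r(1) by (simp add: max_def order.strict_trans2)
      ultimately show "\<exists>\<alpha>\<in>?S. y < ereal \<alpha>" by blast
    qed
  qed
  then show ?thesis
    unfolding holder_exponent_def Greatest_Cn_phi Let_def by simp
qed

theorem theorem4:
  fixes \<phi> :: "real^2 \<Rightarrow> real"
  assumes "\<phi> = refinable_function (1 / 16)"
  shows "holder_exponent \<phi> = 2 \<and>
    (\<forall>x. \<phi> differentiable (at x)) \<and>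
    (\<exists>c>0. \<exists>C>0. \<forall>h\<in>{0<..<1 / 2}.
       ennreal (c * (h * \<bar>ln h\<bar>\<^sup>2)) \<le> derivative_modulus 1 \<phi> h \<and>
       derivative_modulus 1 \<phi> h \<le> ennreal (C * (h * \<bar>ln h\<bar>\<^sup>2)))"
proof -
  have phi: "\<phi> = phi.limit" using assms by (simp add: refinable_function_eq)
  have "\<exists>c>0. \<exists>C>0. \<forall>h\<in>{0<..<1 / 2}.
       ennreal (c * (h * \<bar>ln h\<bar>\<^sup>2)) \<le> derivative_modulus 1 \<phi> h \<and>
       derivative_modulus 1 \<phi> h \<le> ennreal (C * (h * \<bar>ln h\<bar>\<^sup>2))"
    unfolding phi using modulus_phi_asymp
    by (intro exI[of _ "1 / (16 * (ln 2)\<^sup>2)"] exI[of _ "12288 / (ln 2)\<^sup>2"] conjI ballI) auto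
  then show ?thesis
    using phi holder_exponent_phi phi_has_derivative by (auto simp: differentiable_def)
qed

end
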